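(* Consider the problem of minimizing $f(x)=\sum_{i=1}^m f_i(x)$ over $x\in\mathbb{R}^d$, with $f_i:\mathbb{R}^d\to\mathbb{R}$. Assume that: (i) each $f_i$ is convex and has $L$-Lipschitz continuous gradient, i.e. $f_i(x)+\langle\nabla f_i(x),y-x\rangle\le f_i(y)\le f_i(x)+\langle\nabla f_i(x),y-x\rangle+\frac L2\|y-x\|^2$ for all $x,y\in\mathbb{R}^d$; (ii) each $f_i$ can be written as $f_i(x)=\ell(a_i^Tx,b_i)$ such that $\mathrm{supp}(\nabla f_i(x))=\mathrm{supp}(a_i)$, for given data $\{(a_i,b_i)\}_{i=1}^m$ with $a_i\in\mathbb{R}^d$, $b_i\in\mathbb{R}$; (iii) $f$ is $\mu$-strongly convex with $\mu>0$, i.e. $f(y)\ge f(x)+\langle\nabla f(x),y-x\rangle+\frac\mu2\|y-x\|^2$ for all $x,y\in\mathbb{R}^d$. Let $\bar L=L\sqrt{m(1+\Delta)}$ and $\Delta=\min(\Delta_{\rm ave},\Delta_{\max})$. Let $Q$ be an unbiased random quantizer with parameter $\alpha$, and suppose that the fixed, positive step size $\gamma$ satisfies $$\gamma<\min\left(\frac{\mu}{\sqrt\alpha\,\tau\bar L^2},\frac1{\alpha\bar L}\right),$$ where $\tau_k^i\le\tau$ for all $i,k$. Given $\varepsilon_0=f(x_0)-f^\star$, by running $$x_{k+1}=x_k-\gamma\,Q\Big(\sum_{i=1}^m\nabla f_i(x_{k-\tau_k^i})\Big)$$ for at most $$k^\star=(1+2\tau)\frac{\mu}{\gamma(\mu^2-\bar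 L^4\gamma^2\tau^2\alpha)}\log(\varepsilon_0/\varepsilon)$$ iterations, under which $$B^\star=(\log_2d+B)\,c\cdot(1+2\tau)\frac{\mu}{\gamma(\mu^2-\bar L^4\gamma^2\tau^2\alpha)}\log(\varepsilon_0/\varepsilon)$$ bits are sent, we ensure $\mathbf{E}(f(x_k)-f^\star)\le\varepsilon$. Here $B$ is the number of bits required to encode a single vector entry and $\mathbf{E}\{\|Q(v)\|_0\}\le c$.
   Context: $\|\cdot\|$ is the Euclidean norm, $\|v\|_0$ is the number of nonzero entries of $v$, and $\mathrm{supp}(x)=\{i: x^i\ne0\}$, where $x^i$ is the $i$-th entry of $x$. $f^\star=f(x^\star)$ with $x^\star$ the minimizer of $f$; $x_0\in\mathbb{R}^d$ is the initial point, $\varepsilon>0$ is the target accuracy, and $\log$ is the natural logarithm. The nonnegative integer $\tau_k^i$ is the staleness, at iteration $k$, of the gradient information from worker $i$, and $\tau$ is a bound on the staleness; $x_k:=x_0$ for $k<0$. For $\tau=0$ the first term in the minimum is read as $+\infty$. Conflict graph degrees of the data: $\Delta_{\rm ave}=\frac1m\sum_{i=1}^m\sum_{j\ne i}\mathbf 1\{\mathrm{supp}(a_i)\cap\mathrm{supp}(a_j)\ne\emptyset\}$ and $\Delta_{\max}=\max_{i}\sum_{j\ne i}\mathbf 1\{\mathrm{supp}(a_i)\cap\mathrm{supp}(a_j)\ne\emptyset\}$. An unbiased random quantizer with parameter $\alpha$ (finite, positive) is a random mapping $Q:\mathbb{R}^d\to\mathbb{R}^d$ such that for every $v\in\mathbb{R}^d$: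 $\mathrm{supp}(Q(v))\subseteq\mathrm{supp}(v)$, $\mathbf{E}\{Q(v)\}=v$, and $\mathbf{E}\{\|Q(v)\|^2\}\le\alpha\|v\|^2$. The constant $c\le d$ is finite and positive, with $\mathbf{E}\{\|Q(v)\|_0\}\le c$ for any $v\in\mathbb{R}^d$. Each application of $Q$ uses fresh randomness. Bit count: a naive encoding of a vector processed by the quantizer is taken to require $c(\log_2d+B)$ bits, namely $\log_2d$ bits to represent each index and $B$ bits to represent the corresponding vector entry of $c$ nonzero values; one quantized vector is sent per iteration. *)

theory Defs
  imports "HOL-Probability.Probability"
begin

definition gradient :: "('a::real_inner \<Rightarrow> real) \<Rightarrow> 'a \<Rightarrow> 'a" where
  "gradient F x = (THE g. GDERIV F x :> g)"

definition supp :: "real ^ 'd \<Rightarrow> 'd set" where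
  "supp v = {i. v $ i \<noteq> 0}"

definition l0_norm :: "real ^ 'd \<Rightarrow> nat" where
  "l0_norm v = card (supp v)"

text \<open>Degrees in the conflict graph of the data \<open>a 1, \<dots>, a m\<close>: two indices are adjacent
  when the supports of their data vectors intersect.\<close>

definition conflict_degree :: "nat \<Rightarrow> (nat \<Rightarrow> real ^ 'd) \<Rightarrow> nat \<Rightarrow> real" where
  "conflict_degree m a i = (\<Sum>j\<in>{1..m} - {i}. of_bool (supp (a i) \<inter> supp (a j) \<noteq> {}))"

definition conflict_degree_ave :: "nat \<Rightarrow> (nat \<Rightarrow> real ^ 'd) \<Rightarrow> real" where
  "conflict_degree_ave m a = (1 / real m) * (\<Sum>i\<in>{1..m}. conflict_degree m a i)"

definition conflict_degree_max :: "nat \<Rightarrow> (nat \<Rightarrow> real ^ 'd) \<Rightarrow> real" where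
  "conflict_degree_max m a = (MAX i\<in>{1..m}. conflict_degree m a i)"

text \<open>A random mapping is a jointly measurable function \<open>Q\<close> of a random seed \<open>s\<close>, distributed
  according to \<open>D\<close>, and of the input vector \<open>v\<close>. Integrability is required explicitly because
  the Bochner integral of a non-integrable function is \<open>0\<close>; \<open>has_bochner_integral\<close> says that
  \<open>Q s v\<close> is integrable with mean \<open>v\<close>.\<close>

definition unbiased_quantizer ::
    "'s measure \<Rightarrow> ('s \<Rightarrow> real ^ 'd \<Rightarrow> real ^ 'd) \<Rightarrow> real \<Rightarrow> bool" where
  "unbiased_quantizer D Q \<alpha> \<longleftrightarrow>
     prob_space D \<and> 0 < \<alpha> \<and>
     (\<lambda>(s, v). Q s v) \<in> borel_measurable (D \<Otimes>\<^sub>M borel) \<and>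
     (\<forall>v. (AE s in D. supp (Q s v) \<subseteq> supp v) \<and>
          has_bochner_integral D (\<lambda>s. Q s v) v \<and>
          integrable D (\<lambda>s. (norm (Q s v))\<^sup>2) \<and>
          (\<integral>s. (norm (Q s v))\<^sup>2 \<partial>D) \<le> \<alpha> * (norm v)\<^sup>2)"

text \<open>Naive encoding of one quantized vector in dimension \<open>d\<close>: \<open>c\<close> nonzero entries, each given by
  its index (\<open>log 2 d\<close> bits) and its value (\<open>B\<close> bits).\<close>

definition message_bits :: "nat \<Rightarrow> nat \<Rightarrow> real \<Rightarrow> real" where
  "message_bits d B c = c * (log 2 (real d) + real B)"

text \<open>One message is sent per iteration. The number \<open>K\<close> of iterations is real because the
  iteration bound to which this is applied is not rounded to an integer.\<close>

definition bits_sent :: "nat \<Rightarrow> nat \<Rightarrow> real \<Rightarrow> real \<Rightarrow> real" where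
  "bits_sent d B c K = K * message_bits d B c"

text \<open>\<open>x\<close> is the (random) sequence of iterates, with gradients \<open>g i\<close>, staleness
  \<open>delay k i\<close> and seed \<open>\<xi> k\<close> for the application of \<open>Q\<close> in iteration \<open>k\<close>. Truncated
  subtraction on \<open>nat\<close> implements the convention that iterates with negative index are \<open>x0\<close>.\<close>

definition quantized_iteration ::
    "'w measure \<Rightarrow> nat \<Rightarrow> (nat \<Rightarrow> real ^ 'd \<Rightarrow> real ^ 'd) \<Rightarrow> ('s \<Rightarrow> real ^ 'd \<Rightarrow> real ^ 'd)
      \<Rightarrow> (nat \<Rightarrow> 'w \<Rightarrow> 's) \<Rightarrow> (nat \<Rightarrow> nat \<Rightarrow> nat) \<Rightarrow> real \<Rightarrow> real ^ 'd
      \<Rightarrow> (nat \<Rightarrow> 'w \<Rightarrow> real ^ 'd) \<Rightarrow> bool" where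
  "quantized_iteration M m g Q \<xi> delay \<gamma> x0 x \<longleftrightarrow>
     (\<forall>\<omega>\<in>space M. x 0 \<omega> = x0 \<and>
        (\<forall>k. x (Suc k) \<omega> = x k \<omega> - \<gamma> *\<^sub>R Q (\<xi> k \<omega>) (\<Sum>i\<in>{1..m}. g i (x (k - delay k i) \<omega>))))"

end

theory Submission
  imports Defs
begin

text \<open>Let \<open>V k\<close> be the expected optimality gap of \<open>x k\<close>, let \<open>v k\<close> be the delayed sum of gradients that is
  quantized in iteration \<open>k\<close>, and let \<open>G\<close> be the gradient of the objective. Three observations give
  a recurrence for \<open>V\<close>.

  Sparsity. Gradients of losses whose data have disjoint supports are orthogonal, so the squared norm of
  a sum of gradient differences is at most the sum of the squares weighted with one plus the conflict
  degree (\<open>norm_sum_conflict_degree\<close>). With the \<open>L\<close>-Lipschitz bound on each gradient the weights add up to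
  \<open>Lbar\<^sup>2\<close>, so \<open>G\<close> is \<open>Lbar\<close>-Lipschitz. The weighted form also allows a different delay in every summand.

  Quantization. The seed of iteration \<open>k\<close> is independent of \<open>x k\<close> and \<open>v k\<close>, which are functions of the
  earlier seeds (\<open>seed_independent_of_state\<close>). In expectation, \<open>Q (v k)\<close> may be replaced by \<open>v k\<close> in inner
  products with functions of \<open>x k\<close>, at the price of a factor \<open>\<alpha>\<close> in the second moment. Because
  \<open>\<alpha> * \<gamma> * Lbar \<le> 1\<close>, the smoothness bound becomes (\<open>expected_descent\<close>)
  \<open>V (k + 1) \<le> V k - \<gamma> / 2 * E (norm (G (x k)) ^ 2) + \<gamma> / 2 * E (norm (G (x k) - v k) ^ 2)\<close>.
  The first expectation is at least \<open>2 * \<mu> * V k\<close> by strong convexity.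

  Staleness. The difference \<open>G (x k) - v k\<close> is controlled by the at most \<open>\<tau>\<close> updates that a worker has
  missed, these by the directions of the last \<open>\<tau>\<close> iterations, and these again by distances to the
  minimizer of iterates at most \<open>2 * \<tau>\<close> steps old. By strong convexity such distances are bounded by
  gaps, hence (\<open>gap_recurrence\<close>)
  \<open>V (k + 1) \<le> (1 - \<gamma> * \<mu>) * V k + \<gamma> ^ 3 * Lbar ^ 4 * \<tau> ^ 2 * \<alpha> / \<mu> * C\<close>
  where \<open>C\<close> is the largest of \<open>V (k - 2 * \<tau>), \<dots>, V k\<close>.

  The coefficients add up to less than one exactly when \<open>\<gamma> < \<mu> / (sqrt \<alpha> * \<tau> * Lbar ^ 2)\<close>. A recurrence of
  this form decays geometrically, at the price of a root of order \<open>1 + 2 * \<tau>\<close> in the rate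
  (\<open>delayed_linear_recurrence\<close>). Solving for \<open>k\<close> gives the iteration count, and multiplying it by
  the size of a message gives the bit count.\<close>

section \<open>Gradients\<close>

lemma GDERIV_unique:
  assumes "GDERIV F y :> g" "GDERIV F y :> h"
  shows "g = h"
proof -
  have "(\<lambda>v. v \<bullet> g) = (\<lambda>v. v \<bullet> h)"
    using assms has_derivative_unique unfolding gderiv_def by blast
  then have "(g - h) \<bullet> g = (g - h) \<bullet> h" by meson
  then have "(g - h) \<bullet> (g - h) = 0" by (simp add: inner_diff_right)
  then show ?thesis by simp
qed

lemma gradient_eqI: "GDERIV F y :> g \<Longrightarrow> gradient F y = g"
  unfolding gradient_def using GDERIV_unique by blast

lemma GDERIV_gradient:
  fixes F :: "'a::euclidean_space \<Rightarrow> real"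
  assumes "F differentiable (at y)"
  shows "GDERIV F y :> gradient F y"
proof -
  obtain F' where F': "(F has_derivative F') (at y)"
    using assms by (auto simp: differentiable_def)
  then have lin: "linear F'"
    using has_derivative_bounded_linear bounded_linear.linear by blast
  define g where "g = (\<Sum>b\<in>Basis. F' b *\<^sub>R b)"
  have "F' v = v \<bullet> g" for v
  proof -
    have "F' v = F' (\<Sum>b\<in>Basis. (v \<bullet> b) *\<^sub>R b)" by (simp add: euclidean_representation)
    also have "\<dots> = (\<Sum>b\<in>Basis. (v \<bullet> b) * F' b)"
      by (simp add: linear_sum[OF lin] linear_scale[OF lin])
    also have "\<dots> = v \<bullet> g"
      by (simp add: g_def inner_sum_right mult.commute)
    finally show ?thesis .
  qed
  then have "F' = (\<lambda>v. v \<bullet> g)" by auto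
  then have "GDERIV F y :> g" using F' by (simp add: gderiv_def)
  then show ?thesis using gradient_eqI by blast
qed

lemma GDERIV_sum:
  assumes "\<And>i. i \<in> I \<Longrightarrow> GDERIV (f i) y :> g i"
  shows "GDERIV (\<lambda>z. \<Sum>i\<in>I. f i z) y :> (\<Sum>i\<in>I. g i)"
  using assms unfolding gderiv_def inner_sum_right by (rule has_derivative_sum)

section \<open>Smooth and strongly convex functions\<close>

text \<open>A quadratic upper bound on \<open>h\<close> at \<open>y\<close> is minimized by a gradient step of length \<open>1 / L\<close>.\<close>

lemma upper_quadratic_min_along_gradient:
  fixes h :: "'a::real_inner \<Rightarrow> real"
  assumes "0 < L"
    and "\<And>z. h z \<le> h y + p \<bullet> (z - y) + L / 2 * (norm (z - y))\<^sup>2"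
  shows "h (y - (1 / L) *\<^sub>R p) \<le> h y - (norm p)\<^sup>2 / (2 * L)"
proof -
  have "h (y - (1 / L) *\<^sub>R p) \<le> h y - (norm p)\<^sup>2 / L + L / 2 * ((norm p)\<^sup>2 / L\<^sup>2)"
    using assms(2)[of "y - (1 / L) *\<^sub>R p"] \<open>0 < L\<close>
    by (simp add: power2_norm_eq_inner[symmetric] power_mult_distrib power_divide)
  also have "\<dots> = h y - (norm p)\<^sup>2 / (2 * L)"
    using \<open>0 < L\<close> by (simp add: field_simps power2_eq_square)
  finally show ?thesis .
qed

text \<open>After subtraction of the linear function \<open>w \<mapsto> g y \<bullet> w\<close>, convexity makes \<open>y\<close> a global
  minimizer. So a gradient step from \<open>z\<close> cannot go below the value at \<open>y\<close>, which leaves at \<open>z\<close>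
  the excess that this step gains.\<close>

lemma convex_smooth_cocoercive:
  fixes h :: "'a::real_inner \<Rightarrow> real" and g :: "'a \<Rightarrow> 'a"
  assumes "0 < L"
    and convex: "\<And>y z. h y + g y \<bullet> (z - y) \<le> h z"
    and smooth: "\<And>y z. h z \<le> h y + g y \<bullet> (z - y) + L / 2 * (norm (z - y))\<^sup>2"
  shows "h y + g y \<bullet> (z - y) + (norm (g z - g y))\<^sup>2 / (2 * L) \<le> h z"
proof -
  define \<phi> where "\<phi> = (\<lambda>w. h w - g y \<bullet> w)"
  have "\<phi> y \<le> \<phi> (z - (1 / L) *\<^sub>R (g z - g y))"
    using convex[of y "z - (1 / L) *\<^sub>R (g z - g y)"] by (simp add: \<phi>_def inner_diff_right)
  also have "\<dots> \<le> \<phi> z - (norm (g z - g y))\<^sup>2 / (2 * L)"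
  proof (rule upper_quadratic_min_along_gradient[OF \<open>0 < L\<close>])
    fix w show "\<phi> w \<le> \<phi> z + (g z - g y) \<bullet> (w - z) + L / 2 * (norm (w - z))\<^sup>2"
      using smooth[of w z] by (simp add: \<phi>_def inner_diff_right inner_diff_left)
  qed
  finally show ?thesis by (simp add: \<phi>_def inner_diff_right)
qed

text \<open>Co-coercivity at \<open>(y, z)\<close> and at \<open>(z, y)\<close> add up to
  \<open>norm (g z - g y)\<^sup>2 / L \<le> (g z - g y) \<bullet> (z - y)\<close>. This turns the quadratic upper bounds on the
  single losses into the Lipschitz bounds that can be combined along the conflict graph.\<close>

lemma convex_smooth_gradient_lipschitz:
  fixes h :: "'a::real_inner \<Rightarrow> real" and g :: "'a \<Rightarrow> 'a"
  assumes "0 < L"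
    and "\<And>y z. h y + g y \<bullet> (z - y) \<le> h z"
    and "\<And>y z. h z \<le> h y + g y \<bullet> (z - y) + L / 2 * (norm (z - y))\<^sup>2"
  shows "norm (g z - g y) \<le> L * norm (z - y)"
proof -
  have "(norm (g z - g y))\<^sup>2 / L \<le> (g z - g y) \<bullet> (z - y)"
    using convex_smooth_cocoercive[of L h g, OF assms, of y z]
      convex_smooth_cocoercive[of L h g, OF assms, of z y]
    by (simp add: norm_minus_commute inner_diff_left inner_diff_right field_simps)
  also have "\<dots> \<le> norm (g z - g y) * norm (z - y)" by (rule norm_cauchy_schwarz)
  finally have "norm (g z - g y) * norm (g z - g y) \<le> norm (g z - g y) * (L * norm (z - y))"
    using \<open>0 < L\<close> by (simp add: field_simps power2_eq_square)
  then show ?thesis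
    using \<open>0 < L\<close> by (cases "g z = g y") (auto simp: mult_le_cancel_left)
qed

text \<open>This is applied to the whole objective, whose Lipschitz constant \<open>Lbar\<close> comes from the conflict
  graph and can be much smaller than the constant \<open>m * L\<close> that summing the quadratic bounds of the
  losses would give.\<close>

lemma lipschitz_gradient_upper_quadratic:
  fixes h :: "'a::real_inner \<Rightarrow> real" and g :: "'a \<Rightarrow> 'a"
  assumes deriv: "\<And>y. GDERIV h y :> g y"
    and lipschitz: "\<And>y z. norm (g z - g y) \<le> C * norm (z - y)"
  shows "h z \<le> h y + g y \<bullet> (z - y) + C / 2 * (norm (z - y))\<^sup>2"
proof -
  define p where "p = z - y"
  \<comment> \<open>the excess of \<open>h\<close> over the claimed bound along the segment from \<open>y\<close> to \<open>z\<close>, up to the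
    constant \<open>h y\<close>; it decreases because its slope is nonpositive\<close>
  define \<psi> where "\<psi> = (\<lambda>t. h (y + t *\<^sub>R p) - t * (g y \<bullet> p) - C / 2 * t\<^sup>2 * (norm p)\<^sup>2)"
  have slope: "\<exists>d. (\<psi> has_real_derivative d) (at t) \<and> d \<le> 0" if "0 \<le> t" for t
  proof -
    have line: "((\<lambda>t. y + t *\<^sub>R p) has_derivative (\<lambda>s. s *\<^sub>R p)) (at t)"
      by (auto intro!: derivative_eq_intros)
    have "((\<lambda>t. h (y + t *\<^sub>R p)) has_derivative (\<lambda>s. (s *\<^sub>R p) \<bullet> g (y + t *\<^sub>R p))) (at t)"
      using has_derivative_compose[OF line deriv[unfolded gderiv_def]] .
    moreover have "(\<lambda>s. (s *\<^sub>R p) \<bullet> g (y + t *\<^sub>R p)) = (*) (g (y + t *\<^sub>R p) \<bullet> p)"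
      by (auto simp: inner_commute)
    ultimately have "((\<lambda>t. h (y + t *\<^sub>R p)) has_real_derivative g (y + t *\<^sub>R p) \<bullet> p) (at t)"
      by (simp add: has_field_derivative_def)
    then have "(\<psi> has_real_derivative g (y + t *\<^sub>R p) \<bullet> p - g y \<bullet> p - C * t * (norm p)\<^sup>2) (at t)"
      unfolding \<psi>_def by (auto intro!: derivative_eq_intros)
    moreover have "(g (y + t *\<^sub>R p) - g y) \<bullet> p \<le> C * t * (norm p)\<^sup>2"
    proof -
      have "(g (y + t *\<^sub>R p) - g y) \<bullet> p \<le> norm (g (y + t *\<^sub>R p) - g y) * norm p"
        by (rule norm_cauchy_schwarz)
      also have "\<dots> \<le> (C * (t * norm p)) * norm p"
        using lipschitz[of "y + t *\<^sub>R p" y] that by (intro mult_right_mono) auto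
      finally show ?thesis by (simp add: power2_eq_square mult.assoc)
    qed
    ultimately show ?thesis by (auto simp: inner_diff_left)
  qed
  have "\<psi> 0 \<ge> \<psi> 1" by (rule DERIV_nonpos_imp_nonincreasing) (simp_all add: slope)
  then show ?thesis by (simp add: \<psi>_def p_def)
qed

text \<open>The lower quadratic model at \<open>y\<close> has minimum value \<open>h y - norm p ^ 2 / (2 * \<mu>)\<close>. For a minimizer
  \<open>z\<close> this is the Polyak--Lojasiewicz inequality, through which the squared gradient in the descent
  estimate becomes a multiple of the optimality gap.\<close>

lemma strongly_convex_gradient_dominance:
  fixes h :: "'a::real_inner \<Rightarrow> real"
  assumes "0 < \<mu>" and "h z \<ge> h y + p \<bullet> (z - y) + \<mu> / 2 * (norm (z - y))\<^sup>2"
  shows "2 * \<mu> * (h y - h z) \<le> (norm p)\<^sup>2"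
proof -
  have "0 \<le> (norm (p + \<mu> *\<^sub>R (z - y)))\<^sup>2" by simp
  also have "\<dots> = (norm p)\<^sup>2 + 2 * \<mu> * (p \<bullet> (z - y)) + \<mu>\<^sup>2 * (norm (z - y))\<^sup>2"
    unfolding power2_norm_eq_inner by (simp add: algebra_simps inner_commute power2_eq_square)
  finally have "- (norm p)\<^sup>2 \<le> 2 * \<mu> * (p \<bullet> (z - y) + \<mu> / 2 * (norm (z - y))\<^sup>2)"
    by (simp add: algebra_simps power2_eq_square)
  also have "\<dots> \<le> 2 * \<mu> * (h z - h y)" using assms by (intro mult_left_mono) auto
  finally show ?thesis by (simp add: algebra_simps)
qed

section \<open>Sums of sparse vectors and the conflict graph\<close>

lemma norm_sum_power2_le_card:
  fixes v :: "'b \<Rightarrow> 'a::real_normed_vector"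
  shows "(norm (\<Sum>i\<in>I. v i))\<^sup>2 \<le> real (card I) * (\<Sum>i\<in>I. (norm (v i))\<^sup>2)"
proof (cases "finite I")
  case True
  have "(norm (\<Sum>i\<in>I. v i))\<^sup>2 \<le> (\<Sum>i\<in>I. norm (v i))\<^sup>2"
    by (intro power_mono norm_sum) auto
  also have "\<dots> \<le> real (card I) * (\<Sum>i\<in>I. (norm (v i))\<^sup>2)"
    using sum_squared_le_sum_of_squares[of "\<lambda>i. norm (v i)" I] True by (simp add: mult.commute)
  finally show ?thesis .
qed auto

text \<open>Only pairs that are adjacent in the conflict graph, or equal, contribute to the expansion of the
  squared norm, because vectors with disjoint supports are orthogonal. Splitting each remaining
  inner product as \<open>u \<bullet> v \<le> (norm u ^ 2 + norm v ^ 2) / 2\<close> charges every vector once for itself and once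
  for each of its neighbours.\<close>

lemma norm_sum_conflict_degree:
  fixes a u :: "nat \<Rightarrow> real ^ 'd"
  assumes "\<And>i. i \<in> {1..m} \<Longrightarrow> supp (u i) \<subseteq> supp (a i)"
  shows "(norm (\<Sum>i\<in>{1..m}. u i))\<^sup>2 \<le> (\<Sum>i\<in>{1..m}. (1 + conflict_degree m a i) * (norm (u i))\<^sup>2)"
proof -
  define c where "c = (\<lambda>i j. of_bool (i = j \<or> supp (a i) \<inter> supp (a j) \<noteq> {}) :: real)"
  have c_sym: "c i j = c j i" for i j by (auto simp: c_def)
  have degree: "(\<Sum>j\<in>{1..m}. c i j) = 1 + conflict_degree m a i" if "i \<in> {1..m}" for i
  proof -
    have "(\<Sum>j\<in>{1..m}. c i j) = c i i + (\<Sum>j\<in>{1..m} - {i}. c i j)"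
      using that by (intro sum.remove) auto
    also have "(\<Sum>j\<in>{1..m} - {i}. c i j) = conflict_degree m a i"
      unfolding conflict_degree_def c_def by (intro sum.cong) auto
    finally show ?thesis by (simp add: c_def)
  qed
  have pair: "u i \<bullet> u j \<le> c i j * ((norm (u i))\<^sup>2 + (norm (u j))\<^sup>2) / 2"
    if "i \<in> {1..m}" "j \<in> {1..m}" for i j
  proof (cases "i = j \<or> supp (a i) \<inter> supp (a j) \<noteq> {}")
    case True
    have "2 * (norm (u i) * norm (u j)) \<le> (norm (u i))\<^sup>2 + (norm (u j))\<^sup>2"
      using sum_squares_bound[of "norm (u i)" "norm (u j)"] by (simp add: mult.assoc)
    moreover have "c i j = 1" using True by (auto simp: c_def)
    ultimately show ?thesis using norm_cauchy_schwarz[of "u i" "u j"] by simp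
  next
    case False
    then have "supp (u i) \<inter> supp (u j) = {}" using assms that by blast
    then have "u i $ t * u j $ t = 0" for t by (auto simp: supp_def)
    then have "u i \<bullet> u j = 0" unfolding inner_vec_def by (intro sum.neutral) simp
    then show ?thesis using False by (simp add: c_def)
  qed
  have "(norm (\<Sum>i\<in>{1..m}. u i))\<^sup>2 = (\<Sum>i\<in>{1..m}. \<Sum>j\<in>{1..m}. u i \<bullet> u j)"
    unfolding power2_norm_eq_inner inner_sum_left by (simp only: inner_sum_right)
  also have "\<dots> \<le> (\<Sum>i\<in>{1..m}. \<Sum>j\<in>{1..m}. c i j * ((norm (u i))\<^sup>2 + (norm (u j))\<^sup>2) / 2)"
    by (intro sum_mono pair)
  also have "\<dots> = (\<Sum>i\<in>{1..m}. \<Sum>j\<in>{1..m}. c i j * (norm (u i))\<^sup>2 / 2)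
                + (\<Sum>i\<in>{1..m}. \<Sum>j\<in>{1..m}. c i j * (norm (u j))\<^sup>2 / 2)"
    by (simp only: distrib_left add_divide_distrib sum.distrib)
  also have "(\<Sum>i\<in>{1..m}. \<Sum>j\<in>{1..m}. c i j * (norm (u j))\<^sup>2 / 2)
           = (\<Sum>i\<in>{1..m}. \<Sum>j\<in>{1..m}. c i j * (norm (u i))\<^sup>2 / 2)"
    by (subst sum.swap) (simp add: c_sym)
  also have "(\<Sum>i\<in>{1..m}. \<Sum>j\<in>{1..m}. c i j * (norm (u i))\<^sup>2 / 2)
           + (\<Sum>i\<in>{1..m}. \<Sum>j\<in>{1..m}. c i j * (norm (u i))\<^sup>2 / 2)
           = (\<Sum>i\<in>{1..m}. (\<Sum>j\<in>{1..m}. c i j) * (norm (u i))\<^sup>2)"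
    by (simp add: sum.distrib[symmetric] sum_distrib_right)
  also have "\<dots> = (\<Sum>i\<in>{1..m}. (1 + conflict_degree m a i) * (norm (u i))\<^sup>2)"
    by (intro sum.cong refl) (simp only: degree)
  finally show ?thesis .
qed

lemma conflict_degree_nonneg: "0 \<le> conflict_degree m a i"
  by (simp add: conflict_degree_def sum_nonneg)

lemma conflict_degree_ave_nonneg: "0 \<le> conflict_degree_ave m a"
  by (simp add: conflict_degree_ave_def sum_nonneg conflict_degree_nonneg)

lemma conflict_degree_ave_le_max:
  assumes "0 < m"
  shows "conflict_degree_ave m a \<le> conflict_degree_max m a"
proof -
  have "(\<Sum>i\<in>{1..m}. conflict_degree m a i) \<le> of_nat (card {1..m}) * conflict_degree_max m a"
    unfolding conflict_degree_max_def by (intro sum_bounded_above Max_ge) auto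
  then show ?thesis using assms by (simp add: conflict_degree_ave_def field_simps)
qed

text \<open>The weights of the preceding bound add up to the factor under the root in \<open>Lbar\<close>, with the
  average degree: the minimum of the average and the maximal degree is always the average.\<close>

lemma sum_one_plus_conflict_degree:
  assumes "0 < m"
  shows "(\<Sum>i\<in>{1..m}. 1 + conflict_degree m a i) = real m * (1 + conflict_degree_ave m a)"
  using assms by (simp add: conflict_degree_ave_def sum.distrib field_simps)

section \<open>Linear recurrences with a bounded delay\<close>

text \<open>The bound \<open>\<rho> ^ (k - T)\<close> at the old end of the window dominates the whole window, so a step
  contracts this bound, not the current one, by \<open>p + q\<close>. It takes \<open>\<rho> ^ (T + 1) \<ge> p + q\<close> to make up for
  the \<open>T + 1\<close> indices between \<open>k - T\<close> and \<open>k + 1\<close>; this is where the factor \<open>1 + 2 * \<tau>\<close> in the iteration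
  count comes from, with \<open>T = 2 * \<tau>\<close>. If the window is truncated at \<open>0\<close>, fewer indices have to be
  bridged and \<open>\<rho> \<le> 1\<close> suffices. The constant \<open>C\<close> stands for the maximum over the window.\<close>

lemma delayed_linear_recurrence:
  fixes V :: "nat \<Rightarrow> real"
  assumes p: "0 \<le> p" and q: "0 \<le> q" and V0: "0 \<le> V 0"
    and step: "\<And>k C. (\<And>j. \<lbrakk>k - T \<le> j; j \<le> k\<rbrakk> \<Longrightarrow> V j \<le> C) \<Longrightarrow> V (Suc k) \<le> p * V k + q * C"
    and \<rho>: "0 \<le> \<rho>" "\<rho> \<le> 1" "p + q \<le> \<rho> ^ (T + 1)"
  shows "V k \<le> \<rho> ^ k * V 0"
proof (induction k rule: less_induct)
  case (less k)
  show ?case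
  proof (cases k)
    case (Suc n)
    have window: "V j \<le> \<rho> ^ (n - T) * V 0" if "n - T \<le> j" "j \<le> n" for j
    proof -
      have "V j \<le> \<rho> ^ j * V 0" using less.IH that Suc by simp
      also have "\<dots> \<le> \<rho> ^ (n - T) * V 0"
        using that \<rho> V0 by (intro mult_right_mono power_decreasing) auto
      finally show ?thesis .
    qed
    have "V k \<le> p * V n + q * (\<rho> ^ (n - T) * V 0)" using step[OF window] Suc by simp
    also have "\<dots> \<le> p * (\<rho> ^ (n - T) * V 0) + q * (\<rho> ^ (n - T) * V 0)"
      using window[of n] p by (intro add_right_mono mult_left_mono) auto
    also have "\<dots> = (p + q) * (\<rho> ^ (n - T) * V 0)" by (simp add: algebra_simps)
    also have "\<dots> \<le> \<rho> ^ (T + 1) * (\<rho> ^ (n - T) * V 0)"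
      using \<rho> V0 by (intro mult_right_mono) auto
    also have "\<dots> = \<rho> ^ (T + 1 + (n - T)) * V 0" by (simp add: power_add)
    also have "\<dots> \<le> \<rho> ^ k * V 0"
      using \<rho> V0 Suc by (intro mult_right_mono power_decreasing) auto
    finally show ?thesis .
  qed simp
qed

section \<open>Square-integrable random vectors\<close>

lemma norm_add_power2_le:
  fixes v w :: "'a::real_normed_vector"
  shows "(norm (v + w))\<^sup>2 \<le> 2 * (norm v)\<^sup>2 + 2 * (norm w)\<^sup>2"
proof -
  have "(norm (v + w))\<^sup>2 \<le> (norm v + norm w)\<^sup>2"
    by (intro power_mono norm_triangle_ineq) auto
  also have "\<dots> \<le> 2 * (norm v)\<^sup>2 + 2 * (norm w)\<^sup>2"
    using sum_squares_bound[of "norm v" "norm w"] by (simp add: power2_sum)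
  finally show ?thesis .
qed

definition square_integrable :: "'w measure \<Rightarrow> ('w \<Rightarrow> 'b::euclidean_space) \<Rightarrow> bool" where
  "square_integrable M X \<longleftrightarrow> X \<in> borel_measurable M \<and> integrable M (\<lambda>\<omega>. (norm (X \<omega>))\<^sup>2)"

lemma square_integrable_measurable: "square_integrable M X \<Longrightarrow> X \<in> borel_measurable M"
  by (simp add: square_integrable_def)

lemma square_integrable_norm: "square_integrable M X \<Longrightarrow> integrable M (\<lambda>\<omega>. (norm (X \<omega>))\<^sup>2)"
  by (simp add: square_integrable_def)

lemma square_integrable_cong:
  "(\<And>\<omega>. \<omega> \<in> space M \<Longrightarrow> X \<omega> = Y \<omega>) \<Longrightarrow> square_integrable M X \<longleftrightarrow> square_integrable M Y"
  unfolding square_integrable_def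
  by (intro arg_cong2[of _ _ _ _ "(\<and>)"] measurable_cong Bochner_Integration.integrable_cong) auto

lemma square_integrable_add:
  assumes "square_integrable M X" "square_integrable M Y"
  shows "square_integrable M (\<lambda>\<omega>. X \<omega> + Y \<omega>)"
  unfolding square_integrable_def
proof
  show meas: "(\<lambda>\<omega>. X \<omega> + Y \<omega>) \<in> borel_measurable M"
    using assms by (auto simp: square_integrable_def)
  show "integrable M (\<lambda>\<omega>. (norm (X \<omega> + Y \<omega>))\<^sup>2)"
  proof (rule Bochner_Integration.integrable_bound)
    show "integrable M (\<lambda>\<omega>. 2 * (norm (X \<omega>))\<^sup>2 + 2 * (norm (Y \<omega>))\<^sup>2)"
      using assms by (auto simp: square_integrable_def)
    show "AE \<omega> in M. norm ((norm (X \<omega> + Y \<omega>))\<^sup>2) \<le> norm (2 * (norm (X \<omega>))\<^sup>2 + 2 * (norm (Y \<omega>))\<^sup>2)"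
      using norm_add_power2_le by auto
  qed (use meas in measurable)
qed

lemma square_integrable_scaleR:
  "square_integrable M X \<Longrightarrow> square_integrable M (\<lambda>\<omega>. r *\<^sub>R X \<omega>)"
  by (auto simp: square_integrable_def power_mult_distrib)

lemma square_integrable_diff:
  assumes "square_integrable M X" "square_integrable M Y"
  shows "square_integrable M (\<lambda>\<omega>. X \<omega> - Y \<omega>)"
  using square_integrable_add[OF assms(1) square_integrable_scaleR[OF assms(2), of "-1"]] by simp

lemma square_integrable_sum:
  assumes "\<And>i. i \<in> I \<Longrightarrow> square_integrable M (X i)"
  shows "square_integrable M (\<lambda>\<omega>. \<Sum>i\<in>I. X i \<omega>)"
  using assms
  by (induction I rule: infinite_finite_induct)
    (auto simp: square_integrable_add, auto simp: square_integrable_def)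

lemma (in finite_measure) square_integrable_const: "square_integrable M (\<lambda>\<omega>. v)"
  by (simp add: square_integrable_def)

lemma (in finite_measure) square_integrable_lipschitz:
  assumes X: "square_integrable M X"
    and h: "h \<in> borel_measurable borel" "\<And>y z. norm (h y - h z) \<le> C * norm (y - z)"
  shows "square_integrable M (\<lambda>\<omega>. h (X \<omega>))"
  unfolding square_integrable_def
proof
  show meas: "(\<lambda>\<omega>. h (X \<omega>)) \<in> borel_measurable M"
    using square_integrable_measurable[OF X] h(1) by measurable
  show "integrable M (\<lambda>\<omega>. (norm (h (X \<omega>)))\<^sup>2)"
  proof (rule Bochner_Integration.integrable_bound)
    show "integrable M (\<lambda>\<omega>. 2 * (C\<^sup>2 * (norm (X \<omega>))\<^sup>2) + 2 * (norm (h 0))\<^sup>2)"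
      using square_integrable_norm[OF X] by simp
    have "(norm (h y))\<^sup>2 \<le> 2 * (C\<^sup>2 * (norm y)\<^sup>2) + 2 * (norm (h 0))\<^sup>2" for y
      using norm_add_power2_le[of "h y - h 0" "h 0"] power_mono[OF h(2)[of y 0], of 2]
      by (simp add: power_mult_distrib)
    then show "AE \<omega> in M. norm ((norm (h (X \<omega>)))\<^sup>2)
        \<le> norm (2 * (C\<^sup>2 * (norm (X \<omega>))\<^sup>2) + 2 * (norm (h 0))\<^sup>2)"
      by auto
  qed (use meas in measurable)
qed

lemma integrable_inner_square_integrable:
  assumes "square_integrable M X" "square_integrable M Y"
  shows "integrable M (\<lambda>\<omega>. X \<omega> \<bullet> Y \<omega>)"
proof (rule Bochner_Integration.integrable_bound)
  show "integrable M (\<lambda>\<omega>. (norm (X \<omega>))\<^sup>2 + (norm (Y \<omega>))\<^sup>2)"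
    using assms by (auto simp: square_integrable_def)
  show "(\<lambda>\<omega>. X \<omega> \<bullet> Y \<omega>) \<in> borel_measurable M"
    using assms by (auto simp: square_integrable_def)
  have "\<bar>v \<bullet> w\<bar> \<le> (norm v)\<^sup>2 + (norm w)\<^sup>2" for v w :: 'b
    using Cauchy_Schwarz_ineq2[of v w] sum_squares_bound[of "norm v" "norm w"]
      zero_le_power2[of "norm v"] zero_le_power2[of "norm w"] by linarith
  then show "AE \<omega> in M. norm (X \<omega> \<bullet> Y \<omega>) \<le> norm ((norm (X \<omega>))\<^sup>2 + (norm (Y \<omega>))\<^sup>2)"
    by auto
qed

section \<open>Averaging over an independent variable\<close>

text \<open>\<open>indep_var\<close> needs both variables to have values in one type, so it cannot relate a seed and a
  vector. Independence of functions of independent variables is therefore expressed as a product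
  form of their joint law.\<close>

lemma (in prob_space) indep_var_compose_product_law:
  assumes indep: "indep_var M1 X1 M2 X2"
    and Y1: "Y1 \<in> measurable M1 N1" and Y2: "Y2 \<in> measurable M2 N2"
  shows "distr M N1 (\<lambda>\<omega>. Y1 (X1 \<omega>)) \<Otimes>\<^sub>M distr M N2 (\<lambda>\<omega>. Y2 (X2 \<omega>))
    = distr M (N1 \<Otimes>\<^sub>M N2) (\<lambda>\<omega>. (Y1 (X1 \<omega>), Y2 (X2 \<omega>)))"
proof -
  have X: "X1 \<in> measurable M M1" "X2 \<in> measurable M M2"
    using indep_var_rv1[OF indep] indep_var_rv2[OF indep] by auto
  interpret Z: prob_space "distr M N2 (Y2 \<circ> X2)"
    by (intro prob_space_distr measurable_comp[OF X(2) Y2])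
  have "distr M N1 (Y1 \<circ> X1) \<Otimes>\<^sub>M distr M N2 (Y2 \<circ> X2)
      = distr (distr M M1 X1) N1 Y1 \<Otimes>\<^sub>M distr (distr M M2 X2) N2 Y2"
    using X Y1 Y2 by (simp add: distr_distr)
  also have "\<dots> = distr (distr M M1 X1 \<Otimes>\<^sub>M distr M M2 X2) (N1 \<Otimes>\<^sub>M N2) (\<lambda>(s, t). (Y1 s, Y2 t))"
    using X Y1 Y2 Z.sigma_finite_measure_axioms
    by (intro pair_measure_distr) (auto simp: distr_distr)
  also have "distr M M1 X1 \<Otimes>\<^sub>M distr M M2 X2 = distr M (M1 \<Otimes>\<^sub>M M2) (\<lambda>\<omega>. (X1 \<omega>, X2 \<omega>))"
    using indep unfolding indep_var_distribution_eq by blast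
  also have "distr \<dots> (N1 \<Otimes>\<^sub>M N2) (\<lambda>(s, t). (Y1 s, Y2 t))
      = distr M (N1 \<Otimes>\<^sub>M N2) (\<lambda>\<omega>. (Y1 (X1 \<omega>), Y2 (X2 \<omega>)))"
    using X Y1 Y2 by (subst distr_distr) (auto simp: comp_def)
  finally show ?thesis by (simp add: comp_def)
qed

text \<open>Fubini for independent variables: \<open>X\<close> is averaged first, with \<open>Y\<close> frozen. This takes the place of
  conditioning on \<open>Y\<close>.\<close>

lemma (in prob_space) nn_integral_product_law:
  assumes X: "X \<in> measurable M S" and Y: "Y \<in> measurable M T"
    and joint: "distr M S X \<Otimes>\<^sub>M distr M T Y = distr M (S \<Otimes>\<^sub>M T) (\<lambda>\<omega>. (X \<omega>, Y \<omega>))"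
    and \<phi>: "\<phi> \<in> borel_measurable (S \<Otimes>\<^sub>M T)"
  shows "(\<integral>\<^sup>+\<omega>. \<phi> (X \<omega>, Y \<omega>) \<partial>M) = (\<integral>\<^sup>+\<omega>. (\<integral>\<^sup>+s. \<phi> (s, Y \<omega>) \<partial>distr M S X) \<partial>M)"
proof -
  interpret X: prob_space "distr M S X" by (rule prob_space_distr) fact
  interpret Y: prob_space "distr M T Y" by (rule prob_space_distr) fact
  interpret XY: pair_prob_space "distr M S X" "distr M T Y" ..
  have "(\<integral>\<^sup>+\<omega>. \<phi> (X \<omega>, Y \<omega>) \<partial>M) = (\<integral>\<^sup>+z. \<phi> z \<partial>(distr M S X \<Otimes>\<^sub>M distr M T Y))"
    unfolding joint using X Y \<phi> by (subst nn_integral_distr) auto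
  also have "\<dots> = (\<integral>\<^sup>+t. (\<integral>\<^sup>+s. \<phi> (s, t) \<partial>distr M S X) \<partial>distr M T Y)"
    using \<phi> by (subst XY.nn_integral_snd[symmetric]) (auto simp: case_prod_beta')
  also have "\<dots> = (\<integral>\<^sup>+\<omega>. (\<integral>\<^sup>+s. \<phi> (s, Y \<omega>) \<partial>distr M S X) \<partial>M)"
    using \<phi> Y by (subst nn_integral_distr) auto
  finally show ?thesis .
qed

lemma (in prob_space) integral_product_law:
  fixes \<phi> :: "_ \<Rightarrow> real"
  assumes X: "X \<in> measurable M S" and Y: "Y \<in> measurable M T"
    and joint: "distr M S X \<Otimes>\<^sub>M distr M T Y = distr M (S \<Otimes>\<^sub>M T) (\<lambda>\<omega>. (X \<omega>, Y \<omega>))"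
    and \<phi>: "\<phi> \<in> borel_measurable (S \<Otimes>\<^sub>M T)"
    and int: "integrable M (\<lambda>\<omega>. \<phi> (X \<omega>, Y \<omega>))"
  shows "(\<integral>\<omega>. \<phi> (X \<omega>, Y \<omega>) \<partial>M) = (\<integral>\<omega>. (\<integral>s. \<phi> (s, Y \<omega>) \<partial>distr M S X) \<partial>M)"
proof -
  interpret X: prob_space "distr M S X" by (rule prob_space_distr) fact
  interpret Y: prob_space "distr M T Y" by (rule prob_space_distr) fact
  interpret XY: pair_prob_space "distr M S X" "distr M T Y" ..
  have int': "integrable (distr M S X \<Otimes>\<^sub>M distr M T Y) (\<lambda>(s, t). \<phi> (s, t))"
    unfolding joint using X Y \<phi> int by (subst integrable_distr_eq) auto
  have "(\<integral>\<omega>. \<phi> (X \<omega>, Y \<omega>) \<partial>M) = (\<integral>(s, t). \<phi> (s, t) \<partial>(distr M S X \<Otimes>\<^sub>M distr M T Y))"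
    unfolding joint using X Y \<phi> by (subst integral_distr) auto
  also have "\<dots> = (\<integral>t. (\<integral>s. \<phi> (s, t) \<partial>distr M S X) \<partial>distr M T Y)"
    using XY.integral_snd[OF int'] by simp
  also have "\<dots> = (\<integral>\<omega>. (\<integral>s. \<phi> (s, Y \<omega>) \<partial>distr M S X) \<partial>M)"
  proof (subst integral_distr)
    show "(\<lambda>t. \<integral>s. \<phi> (s, t) \<partial>distr M S X) \<in> borel_measurable T"
      using \<phi> by (intro X.borel_measurable_lebesgue_integral) (auto simp: case_prod_beta')
  qed (use Y in auto)
  finally show ?thesis .
qed

section \<open>Quantized iterations with delayed gradients\<close>

text \<open>The update on its own, with arbitrary Lipschitz maps \<open>g i\<close> in the role of the gradients; the
  Lipschitz condition keeps all iterates square-integrable.\<close>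

locale delayed_quantized_iteration = prob_space M
  for M :: "'w measure" +
  fixes D :: "'s measure" and Q :: "'s \<Rightarrow> real ^ 'd \<Rightarrow> real ^ 'd" and \<alpha> :: real
    and \<xi> :: "nat \<Rightarrow> 'w \<Rightarrow> 's" and m :: nat and g :: "nat \<Rightarrow> real ^ 'd \<Rightarrow> real ^ 'd" and C :: real
    and delay :: "nat \<Rightarrow> nat \<Rightarrow> nat" and \<gamma> :: real and x0 :: "real ^ 'd"
    and x :: "nat \<Rightarrow> 'w \<Rightarrow> real ^ 'd"
  assumes quantizer: "unbiased_quantizer D Q \<alpha>"
    and fresh: "indep_vars (\<lambda>_. D) \<xi> UNIV"
    and seed_distr: "\<And>k. distr M D (\<xi> k) = D"
    and iteration: "quantized_iteration M m g Q \<xi> delay \<gamma> x0 x"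
    and lipschitz: "\<And>i y z. i \<in> {1..m} \<Longrightarrow> norm (g i y - g i z) \<le> C * norm (y - z)"
    and C_nonneg: "0 \<le> C"
begin

definition direction :: "nat \<Rightarrow> 'w \<Rightarrow> real ^ 'd" where
  "direction k \<omega> = (\<Sum>i\<in>{1..m}. g i (x (k - delay k i) \<omega>))"

definition quantized_direction :: "nat \<Rightarrow> 'w \<Rightarrow> real ^ 'd" where
  "quantized_direction k \<omega> = Q (\<xi> k \<omega>) (direction k \<omega>)"

lemma x_0: "\<omega> \<in> space M \<Longrightarrow> x 0 \<omega> = x0"
  using iteration by (simp add: quantized_iteration_def)

lemma x_Suc: "\<omega> \<in> space M \<Longrightarrow> x (Suc k) \<omega> = x k \<omega> - \<gamma> *\<^sub>R quantized_direction k \<omega>"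
  using iteration by (simp add: quantized_iteration_def quantized_direction_def direction_def)

lemma Q_measurable [measurable (raw)]:
  assumes "s \<in> measurable N D" "v \<in> borel_measurable N"
  shows "(\<lambda>z. Q (s z) (v z)) \<in> borel_measurable N"
proof -
  have "(\<lambda>(s, v). Q s v) \<in> borel_measurable (D \<Otimes>\<^sub>M borel)"
    using quantizer by (simp add: unbiased_quantizer_def)
  from measurable_compose[OF measurable_Pair[OF assms] this] show ?thesis by simp
qed

lemma g_measurable: "i \<in> {1..m} \<Longrightarrow> g i \<in> borel_measurable borel"
  using lipschitz C_nonneg
  by (intro borel_measurable_continuous_onI lipschitz_on_continuous_on[of C])
    (auto simp: lipschitz_on_def dist_norm)

lemma seed_measurable: "\<xi> k \<in> measurable M D"
  using fresh by (auto simp: indep_vars_def)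

abbreviation past :: "nat \<Rightarrow> 'w \<Rightarrow> nat \<Rightarrow> 's" where
  "past k \<omega> \<equiv> (\<lambda>i\<in>{..<k}. \<xi> i \<omega>)"

text \<open>The seed \<open>\<xi> k\<close> first enters \<open>x (k + 1)\<close>. This makes it independent of \<open>x k\<close> and of the update direction
  of iteration \<open>k\<close>, so the quantizer can be averaged with its argument held fixed.\<close>

lemma iterate_function_of_past:
  "\<exists>h \<in> borel_measurable (PiM {..<k} (\<lambda>_. D)). \<forall>\<omega>\<in>space M. x k \<omega> = h (past k \<omega>)"
proof (induction k rule: less_induct)
  case (less k)
  show ?case
  proof (cases k)
    case 0
    then show ?thesis by (intro bexI[of _ "\<lambda>_. x0"]) (auto simp: x_0)
  next
    case (Suc n)
    have "\<forall>j\<in>{..n}. \<exists>h. h \<in> borel_measurable (PiM {..<j} (\<lambda>_. D)) \<and>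
        (\<forall>\<omega>\<in>space M. x j \<omega> = h (past j \<omega>))"
    proof
      fix j assume "j \<in> {..n}"
      then have "j < k" using Suc by simp
      from less[OF this] show "\<exists>h. h \<in> borel_measurable (PiM {..<j} (\<lambda>_. D)) \<and>
          (\<forall>\<omega>\<in>space M. x j \<omega> = h (past j \<omega>))" by (simp only: Bex_def)
    qed
    from bchoice[OF this] obtain H
      where H: "\<And>j. j \<le> n \<Longrightarrow> H j \<in> borel_measurable (PiM {..<j} (\<lambda>_. D))"
        "\<And>j \<omega>. j \<le> n \<Longrightarrow> \<omega> \<in> space M \<Longrightarrow> x j \<omega> = H j (past j \<omega>)" by auto
    have H_meas: "(\<lambda>\<eta>. H j (restrict \<eta> {..<j})) \<in> borel_measurable (PiM {..<k} (\<lambda>_. D))"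
      if "j \<le> n" for j
      using that Suc by (intro measurable_compose[OF measurable_restrict_subset H(1)]) auto
    define h where "h = (\<lambda>\<eta>. H n (restrict \<eta> {..<n}) - \<gamma> *\<^sub>R Q (\<eta> n)
        (\<Sum>i\<in>{1..m}. g i (H (n - delay n i) (restrict \<eta> {..<n - delay n i}))))"
    have "h \<in> borel_measurable (PiM {..<k} (\<lambda>_. D))"
      unfolding h_def using Suc
      by (intro borel_measurable_diff borel_measurable_scaleR Q_measurable borel_measurable_sum
          measurable_compose[OF H_meas g_measurable] H_meas measurable_component_singleton) auto
    moreover have "x k \<omega> = h (past k \<omega>)" if "\<omega> \<in> space M" for \<omega>
    proof -
      have "restrict (past k \<omega>) {..<j} = past j \<omega>" if "j \<le> n" for j
        using that Suc by (auto simp: restrict_def)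
      then show ?thesis
        using that Suc by (simp add: x_Suc h_def quantized_direction_def direction_def H(2))
    qed
    ultimately show ?thesis by blast
  qed
qed

lemma state_function_of_past:
  "\<exists>h \<in> measurable (PiM {..<k} (\<lambda>_. D)) (borel \<Otimes>\<^sub>M borel).
     \<forall>\<omega>\<in>space M. (x k \<omega>, direction k \<omega>) = h (past k \<omega>)"
proof -
  have "\<forall>j. \<exists>h. h \<in> borel_measurable (PiM {..<j} (\<lambda>_. D)) \<and>
      (\<forall>\<omega>\<in>space M. x j \<omega> = h (past j \<omega>))"
    by (intro allI iterate_function_of_past[unfolded Bex_def])
  from choice[OF this] obtain H
    where H: "\<And>j. H j \<in> borel_measurable (PiM {..<j} (\<lambda>_. D))"
      "\<And>j \<omega>. \<omega> \<in> space M \<Longrightarrow> x j \<omega> = H j (past j \<omega>)" by auto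
  have H_meas: "(\<lambda>\<eta>. H j (restrict \<eta> {..<j})) \<in> borel_measurable (PiM {..<k} (\<lambda>_. D))"
    if "j \<le> k" for j
    using that by (intro measurable_compose[OF measurable_restrict_subset H(1)]) auto
  define h where "h = (\<lambda>\<eta>. (H k (restrict \<eta> {..<k}),
      \<Sum>i\<in>{1..m}. g i (H (k - delay k i) (restrict \<eta> {..<k - delay k i}))))"
  have "h \<in> measurable (PiM {..<k} (\<lambda>_. D)) (borel \<Otimes>\<^sub>M borel)"
    unfolding h_def
    by (intro measurable_Pair borel_measurable_sum measurable_compose[OF H_meas g_measurable] H_meas)
      auto
  moreover have "(x k \<omega>, direction k \<omega>) = h (past k \<omega>)" if "\<omega> \<in> space M" for \<omega>
  proof -
    have "restrict (past k \<omega>) {..<j} = past j \<omega>" if "j \<le> k" for j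
      using that by (auto simp: restrict_def)
    then show ?thesis using that by (simp add: h_def direction_def H(2))
  qed
  ultimately show ?thesis by blast
qed

lemma state_measurable: "(\<lambda>\<omega>. (x k \<omega>, direction k \<omega>)) \<in> measurable M (borel \<Otimes>\<^sub>M borel)"
proof -
  obtain h where h: "h \<in> measurable (PiM {..<k} (\<lambda>_. D)) (borel \<Otimes>\<^sub>M borel)"
    "\<And>\<omega>. \<omega> \<in> space M \<Longrightarrow> (x k \<omega>, direction k \<omega>) = h (past k \<omega>)"
    using state_function_of_past by blast
  have "past k \<in> measurable M (PiM {..<k} (\<lambda>_. D))"
    by (intro measurable_restrict seed_measurable)
  then show ?thesis using measurable_compose[OF _ h(1)] by (subst measurable_cong[OF h(2)])
qed

lemma seed_independent_of_state:
  "distr M D (\<xi> k) \<Otimes>\<^sub>M distr M (borel \<Otimes>\<^sub>M borel) (\<lambda>\<omega>. (x k \<omega>, direction k \<omega>))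
    = distr M (D \<Otimes>\<^sub>M (borel \<Otimes>\<^sub>M borel)) (\<lambda>\<omega>. (\<xi> k \<omega>, x k \<omega>, direction k \<omega>))"
proof -
  obtain h where h: "h \<in> measurable (PiM {..<k} (\<lambda>_. D)) (borel \<Otimes>\<^sub>M borel)"
    "\<And>\<omega>. \<omega> \<in> space M \<Longrightarrow> (x k \<omega>, direction k \<omega>) = h (past k \<omega>)"
    using state_function_of_past by blast
  have "indep_var (PiM {k} (\<lambda>_. D)) (\<lambda>\<omega>. \<lambda>i\<in>{k}. \<xi> i \<omega>) (PiM {..<k} (\<lambda>_. D)) (past k)"
    by (intro indep_var_restrict[OF fresh]) auto
  from indep_var_compose_product_law[OF this measurable_component_singleton[of k] h(1)]
  have "distr M D (\<xi> k) \<Otimes>\<^sub>M distr M (borel \<Otimes>\<^sub>M borel) (\<lambda>\<omega>. h (past k \<omega>))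
      = distr M (D \<Otimes>\<^sub>M (borel \<Otimes>\<^sub>M borel)) (\<lambda>\<omega>. (\<xi> k \<omega>, h (past k \<omega>)))"
    by simp
  moreover have "distr M (borel \<Otimes>\<^sub>M borel) (\<lambda>\<omega>. (x k \<omega>, direction k \<omega>))
      = distr M (borel \<Otimes>\<^sub>M borel) (\<lambda>\<omega>. h (past k \<omega>))"
    by (intro distr_cong h(2)) auto
  moreover have "distr M (D \<Otimes>\<^sub>M (borel \<Otimes>\<^sub>M borel)) (\<lambda>\<omega>. (\<xi> k \<omega>, x k \<omega>, direction k \<omega>))
      = distr M (D \<Otimes>\<^sub>M (borel \<Otimes>\<^sub>M borel)) (\<lambda>\<omega>. (\<xi> k \<omega>, h (past k \<omega>)))"
    by (intro distr_cong) (auto simp: h(2)[symmetric])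
  ultimately show ?thesis by simp
qed

lemma direction_measurable: "direction k \<in> borel_measurable M"
  using measurable_compose[OF state_measurable measurable_snd] by simp

lemma quantized_direction_measurable: "quantized_direction k \<in> borel_measurable M"
  unfolding quantized_direction_def by (intro Q_measurable seed_measurable direction_measurable)

text \<open>The bound is proved for extended nonnegative integrals, because integrability of the quantized
  direction is part of the claim.\<close>

lemma quantizer_second_moment:
  assumes "square_integrable M (direction k)"
  shows square_integrable_quantized_direction: "square_integrable M (quantized_direction k)"
    and expectation_norm_quantized_direction:
      "expectation (\<lambda>\<omega>. (norm (quantized_direction k \<omega>))\<^sup>2)
        \<le> \<alpha> * expectation (\<lambda>\<omega>. (norm (direction k \<omega>))\<^sup>2)"
proof -
  have \<alpha>: "0 < \<alpha>" using quantizer by (simp add: unbiased_quantizer_def)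
  have "(\<integral>\<^sup>+\<omega>. ennreal ((norm (quantized_direction k \<omega>))\<^sup>2) \<partial>M)
      = (\<integral>\<^sup>+\<omega>. (\<integral>\<^sup>+s. ennreal ((norm (Q s (direction k \<omega>)))\<^sup>2) \<partial>D) \<partial>M)"
    using nn_integral_product_law[OF seed_measurable state_measurable seed_independent_of_state,
        of "\<lambda>(s, y, v). ennreal ((norm (Q s v))\<^sup>2)" k]
    by (simp add: seed_distr quantized_direction_def)
  also have "\<dots> \<le> (\<integral>\<^sup>+\<omega>. ennreal (\<alpha> * (norm (direction k \<omega>))\<^sup>2) \<partial>M)"
    using quantizer
    by (intro nn_integral_mono) (auto simp: unbiased_quantizer_def nn_integral_eq_integral)
  also have "\<dots> = ennreal (\<alpha> * expectation (\<lambda>\<omega>. (norm (direction k \<omega>))\<^sup>2))"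
    using assms \<alpha> by (subst nn_integral_eq_integral) (auto simp: square_integrable_def)
  finally have bound: "(\<integral>\<^sup>+\<omega>. ennreal ((norm (quantized_direction k \<omega>))\<^sup>2) \<partial>M)
      \<le> ennreal (\<alpha> * expectation (\<lambda>\<omega>. (norm (direction k \<omega>))\<^sup>2))" .
  then have int: "integrable M (\<lambda>\<omega>. (norm (quantized_direction k \<omega>))\<^sup>2)"
    using quantized_direction_measurable
    by (intro integrableI_bounded) (auto intro: le_less_trans)
  then show "square_integrable M (quantized_direction k)"
    using quantized_direction_measurable by (simp add: square_integrable_def)
  show "expectation (\<lambda>\<omega>. (norm (quantized_direction k \<omega>))\<^sup>2)
        \<le> \<alpha> * expectation (\<lambda>\<omega>. (norm (direction k \<omega>))\<^sup>2)"
    using bound \<alpha> by (subst (asm) nn_integral_eq_integral[OF int]) (auto simp: ennreal_le_iff)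
qed

lemma square_integrable_direction_if:
  assumes "\<And>j. j \<le> k \<Longrightarrow> square_integrable M (x j)"
  shows "square_integrable M (direction k)"
  unfolding direction_def
  using assms
  by (intro square_integrable_sum square_integrable_lipschitz[OF _ g_measurable lipschitz]) auto

lemma square_integrable_iterate: "square_integrable M (x k)"
proof (induction k rule: less_induct)
  case (less k)
  show ?case
  proof (cases k)
    case 0
    then show ?thesis
      using square_integrable_cong[of M "x 0" "\<lambda>_. x0"] by (simp add: x_0 square_integrable_const)
  next
    case (Suc n)
    have "square_integrable M (direction n)"
      using less Suc by (intro square_integrable_direction_if) auto
    then have "square_integrable M (\<lambda>\<omega>. x n \<omega> - \<gamma> *\<^sub>R quantized_direction n \<omega>)"
      using less Suc
      by (intro square_integrable_diff square_integrable_scaleR square_integrable_quantized_direction)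
        auto
    then show ?thesis
      using square_integrable_cong[of M "x k"] Suc by (simp add: x_Suc)
  qed
qed

lemma square_integrable_direction: "square_integrable M (direction k)"
  by (intro square_integrable_direction_if square_integrable_iterate)

text \<open>Unbiasedness: averaging over the fresh seed replaces the quantized direction by the direction.\<close>

lemma expectation_inner_quantized_direction:
  assumes w: "w \<in> borel_measurable borel" "square_integrable M (\<lambda>\<omega>. w (x k \<omega>))"
  shows "expectation (\<lambda>\<omega>. w (x k \<omega>) \<bullet> quantized_direction k \<omega>)
    = expectation (\<lambda>\<omega>. w (x k \<omega>) \<bullet> direction k \<omega>)"
proof -
  have mean: "(\<integral>s. u \<bullet> Q s v \<partial>D) = u \<bullet> v" for u v
    using quantizer
    by (auto simp: unbiased_quantizer_def has_bochner_integral_iff)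
  have "integrable M (\<lambda>\<omega>. w (x k \<omega>) \<bullet> quantized_direction k \<omega>)"
    using w square_integrable_quantized_direction[OF square_integrable_direction]
    by (intro integrable_inner_square_integrable)
  then show ?thesis
    using integral_product_law[OF seed_measurable state_measurable seed_independent_of_state,
        of "\<lambda>(s, y, v). w y \<bullet> Q s v" k] w(1)
    by (simp add: seed_distr quantized_direction_def mean)
qed

end

section \<open>Convergence for a strongly convex objective\<close>

text \<open>The variance of \<open>Q v\<close> is nonnegative, so its second moment is at least the square of the norm of its
  mean \<open>v\<close>.\<close>

lemma quantizer_parameter_ge_1:
  fixes Q :: "'s \<Rightarrow> real ^ 'd \<Rightarrow> real ^ 'd"
  assumes "unbiased_quantizer D Q \<alpha>"
  shows "1 \<le> \<alpha>"
proof -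
  interpret D: prob_space D using assms by (simp add: unbiased_quantizer_def)
  define v :: "real ^ 'd" where "v = 1"
  have v: "0 < (norm v)\<^sup>2" by (simp add: v_def)
  have Q: "integrable D (\<lambda>s. Q s v)" "(\<integral>s. Q s v \<partial>D) = v" "integrable D (\<lambda>s. (norm (Q s v))\<^sup>2)"
    "(\<integral>s. (norm (Q s v))\<^sup>2 \<partial>D) \<le> \<alpha> * (norm v)\<^sup>2"
    using assms by (auto simp: unbiased_quantizer_def has_bochner_integral_iff)
  have mean: "(\<integral>s. v \<bullet> Q s v \<partial>D) = (norm v)\<^sup>2" "integrable D (\<lambda>s. v \<bullet> Q s v)"
    using Q by (auto simp: power2_norm_eq_inner)
  have expand: "(norm (Q s v - v))\<^sup>2 = (norm (Q s v))\<^sup>2 - 2 * (v \<bullet> Q s v) + (norm v)\<^sup>2" for s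
    unfolding power2_norm_eq_inner by (simp add: inner_diff_left inner_diff_right inner_commute)
  have "0 \<le> (\<integral>s. (norm (Q s v - v))\<^sup>2 \<partial>D)" by simp
  also have "\<dots> = (\<integral>s. (norm (Q s v))\<^sup>2 \<partial>D) - (norm v)\<^sup>2"
    unfolding expand using Q mean by (simp add: D.prob_space)
  also have "\<dots> \<le> (\<alpha> - 1) * (norm v)\<^sup>2" using Q by (simp add: algebra_simps)
  finally show ?thesis using v by (simp add: zero_le_mult_iff)
qed

text \<open>Sparsity of the data enters only through the weights \<open>w i\<close>: for the losses of the theorem they are
  \<open>L\<^sup>2\<close> times one plus the conflict degree. In \<open>weighted_lipschitz\<close> every summand has its own pair of
  points, because the workers read iterates of different ages.\<close>

locale asynchronous_quantized_descent =
  delayed_quantized_iteration M D Q \<alpha> \<xi> m g C delay \<gamma> x0 x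
  for M :: "'w measure" and D :: "'s measure" and Q :: "'s \<Rightarrow> real ^ 'd \<Rightarrow> real ^ 'd"
    and \<alpha> \<xi> m g C delay \<gamma> x0 and x :: "nat \<Rightarrow> 'w \<Rightarrow> real ^ 'd" +
  fixes F :: "real ^ 'd \<Rightarrow> real" and w :: "nat \<Rightarrow> real" and Lbar \<mu> :: real and \<tau> :: nat
    and xstar :: "real ^ 'd"
  assumes gradient: "\<And>y. GDERIV F y :> (\<Sum>i\<in>{1..m}. g i y)"
    and w_nonneg: "\<And>i. 0 \<le> w i"
    and weighted_lipschitz: "\<And>u v. (norm (\<Sum>i\<in>{1..m}. g i (u i) - g i (v i)))\<^sup>2
          \<le> (\<Sum>i\<in>{1..m}. w i * (norm (u i - v i))\<^sup>2)"
    and Lbar: "0 < Lbar" "(\<Sum>i\<in>{1..m}. w i) = Lbar\<^sup>2"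
    and mu_pos: "0 < \<mu>"
    and strongly_convex: "\<And>y z. F z \<ge> F y + (\<Sum>i\<in>{1..m}. g i y) \<bullet> (z - y) + \<mu> / 2 * (norm (z - y))\<^sup>2"
    and minimizer: "\<And>y. F xstar \<le> F y"
    and staleness: "\<And>k i. i \<in> {1..m} \<Longrightarrow> delay k i \<le> \<tau>"
    and step_pos: "0 < \<gamma>"
    and step_le: "\<alpha> * \<gamma> * Lbar \<le> 1"
begin

definition G :: "real ^ 'd \<Rightarrow> real ^ 'd" where
  "G y = (\<Sum>i\<in>{1..m}. g i y)"

definition gap :: "nat \<Rightarrow> real" where
  "gap k = expectation (\<lambda>\<omega>. F (x k \<omega>) - F xstar)"

lemma alpha_ge_1: "1 \<le> \<alpha>"
  using quantizer by (rule quantizer_parameter_ge_1)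

lemma G_measurable: "G \<in> borel_measurable borel"
  unfolding G_def by (intro borel_measurable_sum g_measurable)

lemma G_lipschitz: "norm (G y - G z) \<le> Lbar * norm (y - z)"
proof -
  have "(norm (G y - G z))\<^sup>2 \<le> (\<Sum>i\<in>{1..m}. w i * (norm (y - z))\<^sup>2)"
    using weighted_lipschitz[of "\<lambda>_. y" "\<lambda>_. z"] by (simp add: G_def sum_subtractf)
  also have "\<dots> = (Lbar * norm (y - z))\<^sup>2"
    by (simp only: sum_distrib_right[symmetric] Lbar power_mult_distrib)
  finally show ?thesis by (rule power2_le_imp_le) (use Lbar(1) in simp)
qed

lemma F_upper_quadratic: "F z \<le> F y + G y \<bullet> (z - y) + Lbar / 2 * (norm (z - y))\<^sup>2"
  using lipschitz_gradient_upper_quadratic[of F G Lbar] gradient G_lipschitz by (simp add: G_def)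

text \<open>Otherwise a gradient step from the minimizer would decrease \<open>F\<close>.\<close>

lemma G_minimizer: "G xstar = 0"
proof -
  have "F (xstar - (1 / Lbar) *\<^sub>R G xstar) \<le> F xstar - (norm (G xstar))\<^sup>2 / (2 * Lbar)"
    by (intro upper_quadratic_min_along_gradient Lbar F_upper_quadratic)
  with minimizer have "(norm (G xstar))\<^sup>2 / (2 * Lbar) \<le> 0" by (smt (verit))
  then show ?thesis using Lbar(1) by (simp add: divide_le_0_iff)
qed

lemma F_gap_upper: "F y - F xstar \<le> Lbar / 2 * (norm (y - xstar))\<^sup>2"
  using F_upper_quadratic[of y xstar] by (simp add: G_minimizer)

lemma F_gap_lower: "\<mu> / 2 * (norm (y - xstar))\<^sup>2 \<le> F y - F xstar"
  using strongly_convex[of xstar y] unfolding G_def[symmetric] by (simp add: G_minimizer)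

lemma F_gradient_dominance: "2 * \<mu> * (F y - F xstar) \<le> (norm (G y))\<^sup>2"
  using strongly_convex_gradient_dominance[OF mu_pos strongly_convex[of y xstar]] by (simp add: G_def)

lemma mu_le_Lbar: "\<mu> \<le> Lbar"
proof -
  have "\<mu> / 2 * (norm (1 :: real ^ 'd))\<^sup>2 \<le> Lbar / 2 * (norm (1 :: real ^ 'd))\<^sup>2"
    using order_trans[OF F_gap_lower[of "xstar + 1"] F_gap_upper] by simp
  moreover have "0 < (norm (1 :: real ^ 'd))\<^sup>2" by simp
  ultimately show ?thesis by (simp del: zero_less_power2)
qed

text \<open>This keeps the coefficient \<open>1 - \<gamma> * \<mu>\<close> of the recurrence nonnegative. It follows from the step size
  bound since \<open>\<alpha> \<ge> 1\<close> and \<open>\<mu> \<le> Lbar\<close>.\<close>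

lemma step_mu_le_1: "\<gamma> * \<mu> \<le> 1"
proof -
  have "\<gamma> * \<mu> \<le> \<gamma> * Lbar" using mu_le_Lbar step_pos by simp
  also have "\<dots> \<le> \<alpha> * (\<gamma> * Lbar)"
    using mult_right_mono[OF alpha_ge_1, of "\<gamma> * Lbar"] step_pos Lbar(1) by simp
  finally show ?thesis using step_le by (simp add: mult.assoc)
qed

lemma square_integrable_dist: "square_integrable M (\<lambda>\<omega>. x k \<omega> - xstar)"
  by (intro square_integrable_diff square_integrable_iterate square_integrable_const)

lemma square_integrable_gradient: "square_integrable M (\<lambda>\<omega>. G (x k \<omega>))"
  by (rule square_integrable_lipschitz[OF square_integrable_iterate G_measurable G_lipschitz])

lemma integrable_gap: "integrable M (\<lambda>\<omega>. F (x k \<omega>) - F xstar)"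
proof (rule Bochner_Integration.integrable_bound)
  show "integrable M (\<lambda>\<omega>. Lbar / 2 * (norm (x k \<omega> - xstar))\<^sup>2)"
    using square_integrable_norm[OF square_integrable_dist] by simp
  have "continuous_on UNIV F"
    using gradient has_derivative_continuous unfolding gderiv_def
    by (intro continuous_at_imp_continuous_on) blast
  then have "F \<in> borel_measurable borel" by (rule borel_measurable_continuous_onI)
  then show "(\<lambda>\<omega>. F (x k \<omega>) - F xstar) \<in> borel_measurable M"
    using square_integrable_measurable[OF square_integrable_iterate] by measurable
  show "AE \<omega> in M. norm (F (x k \<omega>) - F xstar) \<le> norm (Lbar / 2 * (norm (x k \<omega> - xstar))\<^sup>2)"
    using F_gap_upper minimizer Lbar(1) by (auto simp: abs_mult)
qed

lemma gap_nonneg: "0 \<le> gap k"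
  unfolding gap_def using minimizer by (intro integral_nonneg_AE) auto

lemma expected_distance_le_gap: "expectation (\<lambda>\<omega>. (norm (x k \<omega> - xstar))\<^sup>2) \<le> 2 / \<mu> * gap k"
proof -
  have "expectation (\<lambda>\<omega>. \<mu> / 2 * (norm (x k \<omega> - xstar))\<^sup>2) \<le> gap k"
    unfolding gap_def using square_integrable_norm[OF square_integrable_dist] integrable_gap
    by (intro integral_mono F_gap_lower) auto
  then show ?thesis using mu_pos by (simp add: field_simps)
qed

text \<open>Since the gradients sum to zero at the minimizer, the direction is a sum of gradient differences,
  and the weighted bound compares each summand with the distance of its own stale iterate from the
  minimizer. Expectations are taken term by term; a bound by the largest of these distances would
  leave the expectation of a maximum, which the gaps do not control.\<close>

lemma expected_direction_le_gap:
  assumes "\<And>j. \<lbrakk>k - \<tau> \<le> j; j \<le> k\<rbrakk> \<Longrightarrow> gap j \<le> B"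
  shows "expectation (\<lambda>\<omega>. (norm (direction k \<omega>))\<^sup>2) \<le> Lbar\<^sup>2 * (2 / \<mu> * B)"
proof -
  have "(norm (direction k \<omega>))\<^sup>2 \<le> (\<Sum>i\<in>{1..m}. w i * (norm (x (k - delay k i) \<omega> - xstar))\<^sup>2)" for \<omega>
    using weighted_lipschitz[of "\<lambda>i. x (k - delay k i) \<omega>" "\<lambda>_. xstar"] G_minimizer
    by (simp add: sum_subtractf direction_def G_def)
  then have "expectation (\<lambda>\<omega>. (norm (direction k \<omega>))\<^sup>2)
      \<le> expectation (\<lambda>\<omega>. \<Sum>i\<in>{1..m}. w i * (norm (x (k - delay k i) \<omega> - xstar))\<^sup>2)"
    using square_integrable_norm[OF square_integrable_direction]
      square_integrable_norm[OF square_integrable_dist]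
    by (intro integral_mono) auto
  also have "\<dots> = (\<Sum>i\<in>{1..m}. w i * expectation (\<lambda>\<omega>. (norm (x (k - delay k i) \<omega> - xstar))\<^sup>2))"
    using square_integrable_norm[OF square_integrable_dist]
    by (subst Bochner_Integration.integral_sum) auto
  also have "\<dots> \<le> (\<Sum>i\<in>{1..m}. w i * (2 / \<mu> * B))"
  proof (intro sum_mono mult_left_mono w_nonneg)
    fix i assume i: "i \<in> {1..m}"
    have "gap (k - delay k i) \<le> B" using staleness[OF i, of k] by (intro assms) auto
    then have "2 / \<mu> * gap (k - delay k i) \<le> 2 / \<mu> * B"
      using mu_pos by (intro mult_left_mono) auto
    with expected_distance_le_gap
    show "expectation (\<lambda>\<omega>. (norm (x (k - delay k i) \<omega> - xstar))\<^sup>2) \<le> 2 / \<mu> * B"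
      by (rule order_trans)
  qed
  also have "\<dots> = Lbar\<^sup>2 * (2 / \<mu> * B)" by (simp only: sum_distrib_right[symmetric] Lbar)
  finally show ?thesis .
qed

lemma iterate_difference:
  assumes "\<omega> \<in> space M" "j \<le> k"
  shows "x k \<omega> - x j \<omega> = - \<gamma> *\<^sub>R (\<Sum>s\<in>{j..<k}. quantized_direction s \<omega>)"
  using assms(2)
proof (induction k rule: dec_induct)
  case (step n)
  then show ?case using assms(1) by (simp add: x_Suc algebra_simps)
qed simp

text \<open>Between the iterate that a worker has read and \<open>x k\<close> lie at most \<open>\<tau>\<close> updates, and by Cauchy--Schwarz
  the square of their sum is at most \<open>\<tau>\<close> times the sum of their squares. The bound is the same for all
  workers, so the weights add up to \<open>Lbar\<^sup>2\<close>.\<close>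

lemma staleness_error:
  assumes "\<omega> \<in> space M"
  shows "(norm (G (x k \<omega>) - direction k \<omega>))\<^sup>2
    \<le> Lbar\<^sup>2 * \<gamma>\<^sup>2 * real \<tau> * (\<Sum>s\<in>{k - \<tau>..<k}. (norm (quantized_direction s \<omega>))\<^sup>2)"
proof -
  define S where "S = (\<Sum>s\<in>{k - \<tau>..<k}. (norm (quantized_direction s \<omega>))\<^sup>2)"
  have drift: "(norm (x k \<omega> - x (k - delay k i) \<omega>))\<^sup>2 \<le> \<gamma>\<^sup>2 * real \<tau> * S" if "i \<in> {1..m}" for i
  proof -
    have late: "delay k i \<le> \<tau>" using that staleness by blast
    have "(norm (x k \<omega> - x (k - delay k i) \<omega>))\<^sup>2
        = \<gamma>\<^sup>2 * (norm (\<Sum>s\<in>{k - delay k i..<k}. quantized_direction s \<omega>))\<^sup>2"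
      using iterate_difference[OF assms, of "k - delay k i" k] by (simp add: power_mult_distrib)
    also have "\<dots> \<le> \<gamma>\<^sup>2 * (real (card {k - delay k i..<k})
        * (\<Sum>s\<in>{k - delay k i..<k}. (norm (quantized_direction s \<omega>))\<^sup>2))"
      by (intro mult_left_mono norm_sum_power2_le_card) simp
    also have "\<dots> \<le> \<gamma>\<^sup>2 * (real \<tau> * S)"
      unfolding S_def using late by (intro mult_left_mono mult_mono sum_mono2 sum_nonneg) auto
    finally show ?thesis by (simp add: mult.assoc)
  qed
  have "(norm (G (x k \<omega>) - direction k \<omega>))\<^sup>2
      \<le> (\<Sum>i\<in>{1..m}. w i * (norm (x k \<omega> - x (k - delay k i) \<omega>))\<^sup>2)"
    using weighted_lipschitz[of "\<lambda>_. x k \<omega>" "\<lambda>i. x (k - delay k i) \<omega>"]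
    by (simp add: G_def direction_def sum_subtractf)
  also have "\<dots> \<le> (\<Sum>i\<in>{1..m}. w i * (\<gamma>\<^sup>2 * real \<tau> * S))"
    by (intro sum_mono mult_left_mono drift w_nonneg)
  also have "\<dots> = Lbar\<^sup>2 * (\<gamma>\<^sup>2 * real \<tau> * S)" by (simp only: sum_distrib_right[symmetric] Lbar)
  finally show ?thesis by (simp add: S_def mult.assoc)
qed

text \<open>Two windows of length \<open>\<tau>\<close> compose: the error is made of the directions of the last \<open>\<tau>\<close> iterations,
  and each of these was computed from iterates up to \<open>\<tau>\<close> steps older.\<close>

lemma expected_staleness_error:
  assumes "\<And>j. \<lbrakk>k - 2 * \<tau> \<le> j; j \<le> k\<rbrakk> \<Longrightarrow> gap j \<le> B"
  shows "expectation (\<lambda>\<omega>. (norm (G (x k \<omega>) - direction k \<omega>))\<^sup>2)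
    \<le> 2 * Lbar ^ 4 * \<gamma>\<^sup>2 * (real \<tau>)\<^sup>2 * \<alpha> / \<mu> * B"
proof -
  have B: "0 \<le> B" using gap_nonneg[of k] assms[of k] by simp
  have int: "integrable M (\<lambda>\<omega>. (norm (quantized_direction s \<omega>))\<^sup>2)" for s
    by (intro square_integrable_norm square_integrable_quantized_direction square_integrable_direction)
  have "expectation (\<lambda>\<omega>. (norm (G (x k \<omega>) - direction k \<omega>))\<^sup>2)
      \<le> expectation (\<lambda>\<omega>. Lbar\<^sup>2 * \<gamma>\<^sup>2 * real \<tau> *
            (\<Sum>s\<in>{k - \<tau>..<k}. (norm (quantized_direction s \<omega>))\<^sup>2))"
    using square_integrable_norm[OF square_integrable_diff[OF square_integrable_gradient
          square_integrable_direction]] int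
    by (intro integral_mono staleness_error) auto
  also have "\<dots> = Lbar\<^sup>2 * \<gamma>\<^sup>2 * real \<tau> *
      (\<Sum>s\<in>{k - \<tau>..<k}. expectation (\<lambda>\<omega>. (norm (quantized_direction s \<omega>))\<^sup>2))"
    using int by simp
  also have "\<dots> \<le> Lbar\<^sup>2 * \<gamma>\<^sup>2 * real \<tau> * (real \<tau> * (\<alpha> * (Lbar\<^sup>2 * (2 / \<mu> * B))))"
  proof (rule mult_left_mono)
    have "expectation (\<lambda>\<omega>. (norm (quantized_direction s \<omega>))\<^sup>2) \<le> \<alpha> * (Lbar\<^sup>2 * (2 / \<mu> * B))"
      if "s \<in> {k - \<tau>..<k}" for s
    proof -
      have "expectation (\<lambda>\<omega>. (norm (direction s \<omega>))\<^sup>2) \<le> Lbar\<^sup>2 * (2 / \<mu> * B)"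
        using that by (intro expected_direction_le_gap assms) auto
      then have "\<alpha> * expectation (\<lambda>\<omega>. (norm (direction s \<omega>))\<^sup>2) \<le> \<alpha> * (Lbar\<^sup>2 * (2 / \<mu> * B))"
        using alpha_ge_1 by (intro mult_left_mono) auto
      with expectation_norm_quantized_direction[OF square_integrable_direction]
      show ?thesis by (rule order_trans)
    qed
    then have "(\<Sum>s\<in>{k - \<tau>..<k}. expectation (\<lambda>\<omega>. (norm (quantized_direction s \<omega>))\<^sup>2))
        \<le> of_nat (card {k - \<tau>..<k}) * (\<alpha> * (Lbar\<^sup>2 * (2 / \<mu> * B)))"
      by (rule sum_bounded_above)
    also have "\<dots> \<le> real \<tau> * (\<alpha> * (Lbar\<^sup>2 * (2 / \<mu> * B)))"
      using B alpha_ge_1 mu_pos by (intro mult_right_mono mult_nonneg_nonneg) auto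
    finally show "(\<Sum>s\<in>{k - \<tau>..<k}. expectation (\<lambda>\<omega>. (norm (quantized_direction s \<omega>))\<^sup>2))
        \<le> real \<tau> * (\<alpha> * (Lbar\<^sup>2 * (2 / \<mu> * B)))" .
  qed simp
  also have "\<dots> = 2 * Lbar ^ 4 * \<gamma>\<^sup>2 * (real \<tau>)\<^sup>2 * \<alpha> / \<mu> * B"
    by (simp add: power2_eq_square power4_eq_xxxx)
  finally show ?thesis .
qed

text \<open>Quantization costs at most \<open>\<alpha>\<close> in the second-order term of the smoothness bound, and the step size
  is chosen to absorb it: what remains is \<open>\<gamma> * (norm v ^ 2 / 2 - G \<bullet> v)\<close> for the direction \<open>v\<close>, and
  completing the square gives the two terms below.\<close>

lemma expected_descent:
  "gap (Suc k) \<le> gap k - \<gamma> / 2 * expectation (\<lambda>\<omega>. (norm (G (x k \<omega>)))\<^sup>2)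
    + \<gamma> / 2 * expectation (\<lambda>\<omega>. (norm (G (x k \<omega>) - direction k \<omega>))\<^sup>2)"
proof -
  let ?G = "\<lambda>\<omega>. G (x k \<omega>)" and ?v = "direction k" and ?q = "quantized_direction k"
  note sq = square_integrable_gradient[of k] square_integrable_direction[of k]
    square_integrable_quantized_direction[OF square_integrable_direction, of k]
  note int = integrable_gap[of k] integrable_inner_square_integrable[OF sq(1) sq(3)]
    integrable_inner_square_integrable[OF sq(1) sq(2)]
    square_integrable_norm[OF sq(1)] square_integrable_norm[OF sq(2)] square_integrable_norm[OF sq(3)]
  have "gap (Suc k) \<le> expectation (\<lambda>\<omega>. (F (x k \<omega>) - F xstar) - \<gamma> * (?G \<omega> \<bullet> ?q \<omega>)
      + Lbar / 2 * \<gamma>\<^sup>2 * (norm (?q \<omega>))\<^sup>2)"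
    unfolding gap_def
  proof (rule integral_mono)
    fix \<omega> assume "\<omega> \<in> space M"
    then show "F (x (Suc k) \<omega>) - F xstar \<le> (F (x k \<omega>) - F xstar) - \<gamma> * (?G \<omega> \<bullet> ?q \<omega>)
      + Lbar / 2 * \<gamma>\<^sup>2 * (norm (?q \<omega>))\<^sup>2"
      using F_upper_quadratic[of "x (Suc k) \<omega>" "x k \<omega>"] by (simp add: x_Suc power_mult_distrib)
  qed (use integrable_gap int in auto)
  also have "\<dots> = gap k - \<gamma> * expectation (\<lambda>\<omega>. ?G \<omega> \<bullet> ?q \<omega>)
      + Lbar / 2 * \<gamma>\<^sup>2 * expectation (\<lambda>\<omega>. (norm (?q \<omega>))\<^sup>2)"
    using int by (simp add: gap_def)
  also have "expectation (\<lambda>\<omega>. ?G \<omega> \<bullet> ?q \<omega>) = expectation (\<lambda>\<omega>. ?G \<omega> \<bullet> ?v \<omega>)"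
    by (rule expectation_inner_quantized_direction[OF G_measurable sq(1)])
  also have "Lbar / 2 * \<gamma>\<^sup>2 * expectation (\<lambda>\<omega>. (norm (?q \<omega>))\<^sup>2)
      \<le> \<gamma> / 2 * expectation (\<lambda>\<omega>. (norm (?v \<omega>))\<^sup>2)"
  proof -
    have "Lbar / 2 * \<gamma>\<^sup>2 * expectation (\<lambda>\<omega>. (norm (?q \<omega>))\<^sup>2)
        \<le> Lbar / 2 * \<gamma>\<^sup>2 * (\<alpha> * expectation (\<lambda>\<omega>. (norm (?v \<omega>))\<^sup>2))"
      using Lbar(1) by (intro mult_left_mono expectation_norm_quantized_direction sq(2)) auto
    also have "\<dots> = (\<alpha> * \<gamma> * Lbar) * (\<gamma> / 2 * expectation (\<lambda>\<omega>. (norm (?v \<omega>))\<^sup>2))"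
      by (simp add: power2_eq_square)
    also have "\<dots> \<le> 1 * (\<gamma> / 2 * expectation (\<lambda>\<omega>. (norm (?v \<omega>))\<^sup>2))"
      using step_pos by (intro mult_right_mono step_le mult_nonneg_nonneg) auto
    finally show ?thesis by simp
  qed
  also have "gap k - \<gamma> * expectation (\<lambda>\<omega>. ?G \<omega> \<bullet> ?v \<omega>) + \<gamma> / 2 * expectation (\<lambda>\<omega>. (norm (?v \<omega>))\<^sup>2)
      = gap k - \<gamma> / 2 * expectation (\<lambda>\<omega>. (norm (?G \<omega>))\<^sup>2)
        + \<gamma> / 2 * expectation (\<lambda>\<omega>. (norm (?G \<omega> - ?v \<omega>))\<^sup>2)"
  proof -
    have "(norm (?G \<omega> - ?v \<omega>))\<^sup>2 = (norm (?G \<omega>))\<^sup>2 - 2 * (?G \<omega> \<bullet> ?v \<omega>) + (norm (?v \<omega>))\<^sup>2" for \<omega>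
      unfolding power2_norm_eq_inner by (simp add: inner_diff_left inner_diff_right inner_commute)
    then have "expectation (\<lambda>\<omega>. (norm (?G \<omega> - ?v \<omega>))\<^sup>2) = expectation (\<lambda>\<omega>. (norm (?G \<omega>))\<^sup>2)
        - 2 * expectation (\<lambda>\<omega>. ?G \<omega> \<bullet> ?v \<omega>) + expectation (\<lambda>\<omega>. (norm (?v \<omega>))\<^sup>2)"
      using int by simp
    then show ?thesis by (simp only:) (simp add: algebra_simps)
  qed
  finally show ?thesis by simp
qed

lemma gap_recurrence:
  assumes "\<And>j. \<lbrakk>k - 2 * \<tau> \<le> j; j \<le> k\<rbrakk> \<Longrightarrow> gap j \<le> B"
  shows "gap (Suc k) \<le> (1 - \<gamma> * \<mu>) * gap k + \<gamma> ^ 3 * Lbar ^ 4 * (real \<tau>)\<^sup>2 * \<alpha> / \<mu> * B"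
proof -
  have "2 * \<mu> * gap k \<le> expectation (\<lambda>\<omega>. (norm (G (x k \<omega>)))\<^sup>2)"
    unfolding gap_def integral_mult_right_zero[symmetric]
    using integrable_gap square_integrable_norm[OF square_integrable_gradient]
    by (intro integral_mono F_gradient_dominance) auto
  then have "\<gamma> / 2 * (2 * \<mu> * gap k) \<le> \<gamma> / 2 * expectation (\<lambda>\<omega>. (norm (G (x k \<omega>)))\<^sup>2)"
    using step_pos by (intro mult_left_mono) auto
  moreover have "\<gamma> / 2 * expectation (\<lambda>\<omega>. (norm (G (x k \<omega>) - direction k \<omega>))\<^sup>2)
      \<le> \<gamma> / 2 * (2 * Lbar ^ 4 * \<gamma>\<^sup>2 * (real \<tau>)\<^sup>2 * \<alpha> / \<mu> * B)"
    using step_pos expected_staleness_error[OF assms] by (intro mult_left_mono) auto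
  moreover have "\<gamma> / 2 * (2 * Lbar ^ 4 * \<gamma>\<^sup>2 * (real \<tau>)\<^sup>2 * \<alpha> / \<mu> * B)
      = \<gamma> ^ 3 * Lbar ^ 4 * (real \<tau>)\<^sup>2 * \<alpha> / \<mu> * B"
    by (simp add: power2_eq_square power3_eq_cube)
  moreover have "\<gamma> / 2 * (2 * \<mu> * gap k) = \<gamma> * \<mu> * gap k" by simp
  ultimately have "gap (Suc k) \<le> gap k - \<gamma> * \<mu> * gap k
      + \<gamma> ^ 3 * Lbar ^ 4 * (real \<tau>)\<^sup>2 * \<alpha> / \<mu> * B"
    using expected_descent[of k] by linarith
  then show ?thesis by (simp only: left_diff_distrib mult_1_left)
qed

text \<open>The two coefficients of the recurrence add up to \<open>1 - \<delta>\<close>, where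
  \<open>\<delta> = \<gamma> * (\<mu>\<^sup>2 - Lbar ^ 4 * \<gamma>\<^sup>2 * \<tau>\<^sup>2 * \<alpha>) / \<mu>\<close>, so that \<open>(1 + 2 * \<tau>) / \<delta>\<close> is the factor of the
  logarithm in the iteration count. The rate \<open>exp (- \<delta> / (1 + 2 * \<tau>))\<close> has the power
  \<open>exp (- \<delta>) \<ge> 1 - \<delta>\<close> that the window of length \<open>2 * \<tau>\<close> requires.\<close>

lemma gap_geometric:
  assumes "0 \<le> \<mu>\<^sup>2 - Lbar ^ 4 * \<gamma>\<^sup>2 * (real \<tau>)\<^sup>2 * \<alpha>"
  shows "gap k \<le> exp (- (\<gamma> * (\<mu>\<^sup>2 - Lbar ^ 4 * \<gamma>\<^sup>2 * (real \<tau>)\<^sup>2 * \<alpha>) / \<mu>) / (1 + 2 * real \<tau>)) ^ k * gap 0"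
proof -
  define \<delta> where "\<delta> = \<gamma> * (\<mu>\<^sup>2 - Lbar ^ 4 * \<gamma>\<^sup>2 * (real \<tau>)\<^sup>2 * \<alpha>) / \<mu>"
  have \<delta>: "0 \<le> \<delta>" using assms step_pos mu_pos by (simp add: \<delta>_def)
  have "(1 - \<gamma> * \<mu>) + \<gamma> ^ 3 * Lbar ^ 4 * (real \<tau>)\<^sup>2 * \<alpha> / \<mu> = 1 - \<delta>"
    using mu_pos by (simp add: \<delta>_def field_simps power2_eq_square power3_eq_cube)
  also have "\<dots> \<le> exp (- \<delta>)" using exp_ge_add_one_self[of "- \<delta>"] by simp
  also have "\<dots> = exp (- \<delta> / (1 + 2 * real \<tau>)) ^ (2 * \<tau> + 1)"
    unfolding exp_of_nat_mult[symmetric] by (simp add: field_simps)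
  finally have rate: "(1 - \<gamma> * \<mu>) + \<gamma> ^ 3 * Lbar ^ 4 * (real \<tau>)\<^sup>2 * \<alpha> / \<mu>
      \<le> exp (- \<delta> / (1 + 2 * real \<tau>)) ^ (2 * \<tau> + 1)" .
  have "gap k \<le> exp (- \<delta> / (1 + 2 * real \<tau>)) ^ k * gap 0"
  proof (rule delayed_linear_recurrence)
    show "0 \<le> 1 - \<gamma> * \<mu>" using step_mu_le_1 by simp
    show "0 \<le> \<gamma> ^ 3 * Lbar ^ 4 * (real \<tau>)\<^sup>2 * \<alpha> / \<mu>" using step_pos mu_pos alpha_ge_1 by simp
    show "gap (Suc n) \<le> (1 - \<gamma> * \<mu>) * gap n + \<gamma> ^ 3 * Lbar ^ 4 * (real \<tau>)\<^sup>2 * \<alpha> / \<mu> * B"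
      if "\<And>j. \<lbrakk>n - 2 * \<tau> \<le> j; j \<le> n\<rbrakk> \<Longrightarrow> gap j \<le> B" for n B
      using that by (rule gap_recurrence)
    show "exp (- \<delta> / (1 + 2 * real \<tau>)) \<le> 1" using \<delta> by simp
  qed (use rate gap_nonneg in simp_all)
  then show ?thesis by (simp add: \<delta>_def)
qed

lemma gap_0: "gap 0 = F x0 - F xstar"
proof -
  have "gap 0 = expectation (\<lambda>\<omega>. F x0 - F xstar)"
    unfolding gap_def by (intro Bochner_Integration.integral_cong) (auto simp: x_0)
  then show ?thesis by (simp add: prob_space)
qed

lemma gap_le_accuracy:
  assumes rate: "0 < \<mu>\<^sup>2 - Lbar ^ 4 * \<gamma>\<^sup>2 * (real \<tau>)\<^sup>2 * \<alpha>" and "0 < \<epsilon>"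
    and k: "(1 + 2 * real \<tau>) * (\<mu> / (\<gamma> * (\<mu>\<^sup>2 - Lbar ^ 4 * \<gamma>\<^sup>2 * (real \<tau>)\<^sup>2 * \<alpha>)))
      * ln ((F x0 - F xstar) / \<epsilon>) \<le> real k"
  shows "gap k \<le> \<epsilon>"
proof -
  define r where "r = \<gamma> * (\<mu>\<^sup>2 - Lbar ^ 4 * \<gamma>\<^sup>2 * (real \<tau>)\<^sup>2 * \<alpha>) / \<mu> / (1 + 2 * real \<tau>)"
  have r: "0 < r" using rate step_pos mu_pos by (simp add: r_def add_pos_nonneg)
  have "gap k \<le> exp (- r) ^ k * gap 0"
    using gap_geometric[of k] rate by (simp add: r_def)
  also have "\<dots> = exp (- (real k * r)) * (F x0 - F xstar)"
    by (simp add: gap_0 exp_of_nat_mult[symmetric])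
  (* a start at the minimizer is separate because ln 0 = 0 carries no information *)
  also have "\<dots> \<le> \<epsilon>"
  proof (cases "F x0 = F xstar")
    case False
    then have gap0: "0 < F x0 - F xstar" using minimizer[of x0] by simp
    have "(1 + 2 * real \<tau>) * (\<mu> / (\<gamma> * (\<mu>\<^sup>2 - Lbar ^ 4 * \<gamma>\<^sup>2 * (real \<tau>)\<^sup>2 * \<alpha>))) = 1 / r"
      by (simp add: r_def)
    from k[unfolded this] have "ln ((F x0 - F xstar) / \<epsilon>) / r \<le> real k" by simp
    then have "ln ((F x0 - F xstar) / \<epsilon>) \<le> real k * r"
      using r by (simp add: pos_divide_le_eq)
    then have "exp (- (real k * r)) \<le> exp (- ln ((F x0 - F xstar) / \<epsilon>))" by simp
    also have "\<dots> = \<epsilon> / (F x0 - F xstar)"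
      using gap0 \<open>0 < \<epsilon>\<close> by (simp add: exp_minus)
    finally show ?thesis using gap0 by (simp add: field_simps)
  qed (use \<open>0 < \<epsilon>\<close> in simp)
  finally show ?thesis .
qed

end

section \<open>The iteration and bit count\<close>

text \<open>An upper bound of lower curvature than a strongly convex lower bound is impossible. This rules out
  \<open>m = 0\<close> and \<open>L \<le> 0\<close>.\<close>

lemma smoothness_pos:
  fixes F :: "'a::euclidean_space \<Rightarrow> real"
  assumes "0 < \<mu>"
    and "\<And>y z. F z \<ge> F y + p y \<bullet> (z - y) + \<mu> / 2 * (norm (z - y))\<^sup>2"
    and "\<And>y z. F z \<le> F y + p y \<bullet> (z - y) + K / 2 * (norm (z - y))\<^sup>2"
  shows "0 < K"
proof -
  obtain b :: 'a where b: "norm b = 1" using norm_Basis nonempty_Basis by blast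
  show ?thesis using assms(1) assms(2)[of 0 b] assms(3)[of b 0] b by simp
qed

theorem corollary4p6:
  fixes m :: nat
    and f :: "nat \<Rightarrow> real ^ 'd \<Rightarrow> real"
    and a :: "nat \<Rightarrow> real ^ 'd" and b :: "nat \<Rightarrow> real" and l :: "real \<Rightarrow> real \<Rightarrow> real"
    and L \<mu> \<alpha> c \<gamma> \<epsilon> :: real
    and \<tau> B :: nat
    and x0 xstar :: "real ^ 'd"
    and D :: "'s measure" and Q :: "'s \<Rightarrow> real ^ 'd \<Rightarrow> real ^ 'd"
    and M :: "'w measure" and \<xi> :: "nat \<Rightarrow> 'w \<Rightarrow> 's"
    and delay :: "nat \<Rightarrow> nat \<Rightarrow> nat"
    and x :: "nat \<Rightarrow> 'w \<Rightarrow> real ^ 'd"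
  defines "F \<equiv> \<lambda>y. \<Sum>i\<in>{1..m}. f i y"
  defines "\<Delta> \<equiv> min (conflict_degree_ave m a) (conflict_degree_max m a)"
  defines "Lbar \<equiv> L * sqrt (real m * (1 + \<Delta>))"
  defines "\<epsilon>0 \<equiv> F x0 - F xstar"
  defines "kstar \<equiv> (1 + 2 * real \<tau>) * (\<mu> / (\<gamma> * (\<mu>\<^sup>2 - Lbar ^ 4 * \<gamma>\<^sup>2 * (real \<tau>)\<^sup>2 * \<alpha>)))
                     * ln (\<epsilon>0 / \<epsilon>)"
  defines "Bstar \<equiv> (log 2 (real CARD('d)) + real B) * c * (1 + 2 * real \<tau>)
                     * (\<mu> / (\<gamma> * (\<mu>\<^sup>2 - Lbar ^ 4 * \<gamma>\<^sup>2 * (real \<tau>)\<^sup>2 * \<alpha>)))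
                     * ln (\<epsilon>0 / \<epsilon>)"
  assumes differentiable: "\<And>i y. i \<in> {1..m} \<Longrightarrow> f i differentiable (at y)"
    and convex: "\<And>i y z. i \<in> {1..m} \<Longrightarrow> f i y + gradient (f i) y \<bullet> (z - y) \<le> f i z"
    and smooth: "\<And>i y z. i \<in> {1..m} \<Longrightarrow>
                   f i z \<le> f i y + gradient (f i) y \<bullet> (z - y) + L / 2 * (norm (z - y))\<^sup>2"
    and loss: "\<And>i y. i \<in> {1..m} \<Longrightarrow> f i y = l (a i \<bullet> y) (b i)"
    and loss_supp: "\<And>i y. i \<in> {1..m} \<Longrightarrow> supp (gradient (f i) y) = supp (a i)"
    and mu_pos: "0 < \<mu>"
    and strongly_convex: "\<And>y z. F z \<ge> F y + gradient F y \<bullet> (z - y) + \<mu> / 2 * (norm (z - y))\<^sup>2"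
    and minimizer: "\<And>y. F xstar \<le> F y"
    and eps_pos: "0 < \<epsilon>"
    and quantizer: "unbiased_quantizer D Q \<alpha>"
    and c_range: "0 < c" "c \<le> real CARD('d)"
    and sparsity: "\<And>v. (\<integral>s. real (l0_norm (Q s v)) \<partial>D) \<le> c"
    and prob: "prob_space M"
    and fresh: "prob_space.indep_vars M (\<lambda>_. D) \<xi> UNIV"
    and seed_distr: "\<And>k. distr M D (\<xi> k) = D"
    and staleness: "\<And>k i. i \<in> {1..m} \<Longrightarrow> delay k i \<le> \<tau>"
    and step_pos: "0 < \<gamma>"
    and step_delay: "\<tau> > 0 \<Longrightarrow> \<gamma> < \<mu> / (sqrt \<alpha> * real \<tau> * Lbar\<^sup>2)"
    and step_quantizer: "\<gamma> < 1 / (\<alpha> * Lbar)"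
    and iterates: "quantized_iteration M m (\<lambda>i. gradient (f i)) Q \<xi> delay \<gamma> x0 x"
  shows "(\<forall>k::nat. kstar \<le> real k \<longrightarrow>
            integrable M (\<lambda>\<omega>. F (x k \<omega>) - F xstar) \<and>
            (\<integral>\<omega>. (F (x k \<omega>) - F xstar) \<partial>M) \<le> \<epsilon>)
         \<and> bits_sent CARD('d) B c kstar = Bstar"
proof -
  let ?g = "\<lambda>i. gradient (f i)"
  define w where "w = (\<lambda>i. L\<^sup>2 * (1 + conflict_degree m a i))"
  have deriv: "GDERIV F y :> (\<Sum>i\<in>{1..m}. ?g i y)" for y
    unfolding F_def by (intro GDERIV_sum GDERIV_gradient differentiable)
  have gradient_F: "gradient F y = (\<Sum>i\<in>{1..m}. ?g i y)" for y
    using deriv by (rule gradient_eqI)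
  have "F z \<le> F y + gradient F y \<bullet> (z - y) + (real m * L) / 2 * (norm (z - y))\<^sup>2" for y z
  proof -
    have "F z \<le> (\<Sum>i\<in>{1..m}. f i y + ?g i y \<bullet> (z - y) + L / 2 * (norm (z - y))\<^sup>2)"
      unfolding F_def by (intro sum_mono smooth)
    then show ?thesis
      unfolding gradient_F by (simp add: F_def sum.distrib inner_sum_left mult.assoc)
  qed
  from smoothness_pos[OF mu_pos strongly_convex this]
  have L: "0 < L" and m: "0 < m" by (auto simp: zero_less_mult_iff)
  have \<alpha>: "1 \<le> \<alpha>" using quantizer by (rule quantizer_parameter_ge_1)
  have \<Delta>: "\<Delta> = conflict_degree_ave m a"
    using conflict_degree_ave_le_max[OF m, of a] by (simp add: \<Delta>_def)
  then have \<Delta>_nonneg: "0 \<le> \<Delta>" by (simp add: conflict_degree_ave_nonneg)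
  have Lbar_pos: "0 < Lbar" using L m \<Delta>_nonneg by (simp add: Lbar_def)
  have sum_w: "(\<Sum>i\<in>{1..m}. w i) = Lbar\<^sup>2"
    using m \<Delta>_nonneg
    by (simp only: w_def sum_distrib_left[symmetric] sum_one_plus_conflict_degree[OF m] Lbar_def
        power_mult_distrib \<Delta>) simp
  have gradient_lipschitz: "norm (?g i y - ?g i z) \<le> L * norm (y - z)" if "i \<in> {1..m}" for i y z
    using that by (intro convex_smooth_gradient_lipschitz[of L "f i"] L convex smooth)
  have weighted: "(norm (\<Sum>i\<in>{1..m}. ?g i (u i) - ?g i (v i)))\<^sup>2
      \<le> (\<Sum>i\<in>{1..m}. w i * (norm (u i - v i))\<^sup>2)" for u v
  proof -
    have "(norm (\<Sum>i\<in>{1..m}. ?g i (u i) - ?g i (v i)))\<^sup>2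
        \<le> (\<Sum>i\<in>{1..m}. (1 + conflict_degree m a i) * (norm (?g i (u i) - ?g i (v i)))\<^sup>2)"
    proof (rule norm_sum_conflict_degree)
      fix i assume "i \<in> {1..m}"
      then have "supp (?g i (u i)) = supp (a i)" "supp (?g i (v i)) = supp (a i)"
        by (simp_all add: loss_supp)
      then show "supp (?g i (u i) - ?g i (v i)) \<subseteq> supp (a i)"
        by (fastforce simp: supp_def)
    qed
    also have "\<dots> \<le> (\<Sum>i\<in>{1..m}. (1 + conflict_degree m a i) * (L * norm (u i - v i))\<^sup>2)"
      by (intro sum_mono mult_left_mono power_mono gradient_lipschitz)
        (auto simp: conflict_degree_nonneg add_nonneg_nonneg)
    finally show ?thesis by (simp add: w_def power_mult_distrib mult.assoc mult.left_commute)
  qed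
  interpret prob_space M by (rule prob)
  interpret asynchronous_quantized_descent M D Q \<alpha> \<xi> m ?g L delay \<gamma> x0 x F w Lbar \<mu> \<tau> xstar
  proof unfold_locales
    show "0 \<le> w i" for i by (simp add: w_def conflict_degree_nonneg)
    show "F z \<ge> F y + (\<Sum>i\<in>{1..m}. ?g i y) \<bullet> (z - y) + \<mu> / 2 * (norm (z - y))\<^sup>2" for y z
      using strongly_convex[of y z] by (simp add: gradient_F)
    show "\<alpha> * \<gamma> * Lbar \<le> 1"
      using step_quantizer \<alpha> Lbar_pos by (simp add: field_simps)
  qed (use quantizer fresh seed_distr iterates gradient_lipschitz L deriv weighted Lbar_pos sum_w
      mu_pos minimizer staleness step_pos in auto)
  have rate: "0 < \<mu>\<^sup>2 - Lbar ^ 4 * \<gamma>\<^sup>2 * (real \<tau>)\<^sup>2 * \<alpha>"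
  proof (cases "\<tau> = 0")
    case False
    then have "\<gamma> * (sqrt \<alpha> * real \<tau> * Lbar\<^sup>2) < \<mu>"
      using step_delay \<alpha> Lbar_pos by (simp add: pos_less_divide_eq)
    then have "(\<gamma> * (sqrt \<alpha> * real \<tau> * Lbar\<^sup>2))\<^sup>2 < \<mu>\<^sup>2"
      using step_pos \<alpha> by (intro power_strict_mono) auto
    then show ?thesis using \<alpha> by (simp add: power_mult_distrib algebra_simps)
  qed (use mu_pos in simp)
  have "gap k \<le> \<epsilon>" if "kstar \<le> real k" for k
    using gap_le_accuracy[OF rate eps_pos] that by (simp add: kstar_def \<epsilon>0_def)
  moreover have "bits_sent CARD('d) B c kstar = Bstar"
    by (simp add: bits_sent_def message_bits_def kstar_def Bstar_def)
  ultimately show ?thesis using integrable_gap by (simp add: gap_def)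
qed

end
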